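(* Let $\mathcal{A}$ be a central, essential, supersolvable hyperplane arrangement in $\mathbb{R}^d$, let $F=\{X_i\}_{i=0}^d$ be a modular flag for $\mathcal{A}$, and let $c_0$ be any chamber incident to $F$. Then: (i) there is a unique minimal gallery $r_0$ from $c_0$ to $-c_0$ incident to $F$; (ii) this $r_0$ is an $L_2$-accessible vertex of the graph $G_2$ of minimal galleries from $c_0$ to $-c_0$, i.e. $d_{G_2}(r_0,r)=|L_2(r_0,r)|$ for every minimal gallery $r$ from $c_0$ to $-c_0$.
   Context: A central, essential arrangement $\mathcal{A}$ is a finite set of linear hyperplanes in $\mathbb{R}^d$ with common intersection $\{0\}$; $L_i$ is the set of codimension-$i$ intersections of its hyperplanes. Chambers are components of the complement; $L_1(c,c')$ is the set of hyperplanes separating $c,c'$. A minimal gallery is a shortest path in the graph on chambers with $c,c'$ adjacent iff $|L_1(c,c')|=1$; one from $c_0$ to $-c_0$ crosses every hyperplane exactly once and is determined by the crossing order. For such galleries $r,r'$, $L_2(r,r')$ is the set of $X\in L_2$ such that $r,r'$ cross the hyperplanes containing $X$ in different orders; $G_2$ has these galleries as vertices, $r,r'$ adjacent iff $|L_2(r,r')|=1$, and $d_{G_2}$ is its graph distance. A modular coatom is a line $\ell\in L_{d-1}$ such that for any distinct $H,H'\in\mathcal{A}$ not containing $\ell$, $\ell+(H\cap H')\in\mathcal{A}$. $\mathcal{A}$ is supersolvable if $d=1$ or it has a modular coatom $\ell$ with the localization $\mathcal{A}_\ell=\{H/\ell:H\supseteq\ell\}$ in $\mathbb{R}^d/\ell$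 supersolvable. A flag is a chain $\{0\}=X_0\subset\cdots\subset X_d=\mathbb{R}^d$ of intersection subspaces with $\dim X_i=i$; it is modular if $X_1$ is a modular coatom of $\mathcal{A}$ and each $X_i/X_{i-1}$ is a modular coatom of $\mathcal{A}_{X_{i-1}}$ (hyperplanes containing $X_{i-1}$, modulo $X_{i-1}$). A chamber is incident to a subspace $X$ if its closure meets $X$ in a set of dimension $\dim X$, and to $F$ if incident to every $X_i$. A minimal gallery from $c_0$ to $-c_0$ is incident to $F$ if whenever $i<j$ it crosses all hyperplanes containing $X_j$ before any hyperplane containing $X_i$ but not $X_j$. *)

theory Defs
  imports "HOL-Analysis.Analysis" "HOL-Library.Extended_Nat"
begin

definition linear_hyperplane :: "'a::euclidean_space set \<Rightarrow> bool" where
  "linear_hyperplane H \<longleftrightarrow> (\<exists>a. a \<noteq> 0 \<and> H = {x. a \<bullet> x = 0})"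

definition central_arrangement :: "'a::euclidean_space set set \<Rightarrow> bool" where
  "central_arrangement A \<longleftrightarrow> finite A \<and> (\<forall>H\<in>A. linear_hyperplane H)"

definition essential :: "'a::euclidean_space set set \<Rightarrow> bool" where
  "essential A \<longleftrightarrow> \<Inter>A = {0}"

definition intersections :: "'a::euclidean_space set set \<Rightarrow> 'a set set" where
  "intersections A = {\<Inter>S | S. S \<subseteq> A}"

definition L_codim :: "'a::euclidean_space set set \<Rightarrow> nat \<Rightarrow> 'a set set" where
  "L_codim A i = {X \<in> intersections A. dim X + i = DIM('a)}"

text \<open>Modular coatom of the localization A_X (viewed in R^d/X), expressed in R^d:
  Y/X is a line of A_X in R^d/X, and for distinct H, H' of A_X not containing Y,
  Y + (H \<inter> H') is in A_X (equivalently: in A, since it contains X).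
  For X = {0} this is exactly the notion of a modular coatom of A.\<close>
definition modular_coatom_rel :: "'a::euclidean_space set set \<Rightarrow> 'a set \<Rightarrow> 'a set \<Rightarrow> bool" where
  "modular_coatom_rel A X Y \<longleftrightarrow>
     Y \<in> intersections A \<and> X \<subseteq> Y \<and> dim Y = dim X + 1 \<and>
     (\<forall>H\<in>A. \<forall>H'\<in>A. X \<subseteq> H \<longrightarrow> X \<subseteq> H' \<longrightarrow> H \<noteq> H' \<longrightarrow> \<not> Y \<subseteq> H \<longrightarrow> \<not> Y \<subseteq> H' \<longrightarrow>
        {y + z | y z. y \<in> Y \<and> z \<in> H \<inter> H'} \<in> A)"

text \<open>\<open>ss_local A X\<close>: the localization A_X, viewed in R^d/X, is supersolvable
  (recursive definition: dimension of R^d/X is 1, or there is a modular coatom Y/X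
  of A_X with (A_X)_(Y/X) = A_Y supersolvable).\<close>
inductive ss_local :: "'a::euclidean_space set set \<Rightarrow> 'a set \<Rightarrow> bool" for A where
  base: "dim X + 1 = DIM('a) \<Longrightarrow> ss_local A X"
| step: "modular_coatom_rel A X Y \<Longrightarrow> ss_local A Y \<Longrightarrow> ss_local A X"

definition supersolvable :: "'a::euclidean_space set set \<Rightarrow> bool" where
  "supersolvable A \<longleftrightarrow> ss_local A {0}"

definition is_flag :: "'a::euclidean_space set set \<Rightarrow> (nat \<Rightarrow> 'a set) \<Rightarrow> bool" where
  "is_flag A F \<longleftrightarrow> F 0 = {0} \<and> F DIM('a) = UNIV \<and>
     (\<forall>i\<le>DIM('a). F i \<in> intersections A \<and> dim (F i) = i) \<and>
     (\<forall>i<DIM('a). F i \<subset> F (Suc i))"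

definition modular_flag :: "'a::euclidean_space set set \<Rightarrow> (nat \<Rightarrow> 'a set) \<Rightarrow> bool" where
  "modular_flag A F \<longleftrightarrow> is_flag A F \<and>
     (\<forall>i. 1 \<le> i \<and> i \<le> DIM('a) \<longrightarrow> modular_coatom_rel A (F (i - 1)) (F i))"

definition chambers :: "'a::euclidean_space set set \<Rightarrow> 'a set set" where
  "chambers A = components (- \<Union>A)"

definition sep :: "'a::euclidean_space set set \<Rightarrow> 'a set \<Rightarrow> 'a set \<Rightarrow> 'a set set" where
  "sep A c c' = {H \<in> A. \<forall>x\<in>c. \<forall>y\<in>c'. \<not> connected_component (- H) x y}"

definition chamber_adj :: "'a::euclidean_space set set \<Rightarrow> 'a set \<Rightarrow> 'a set \<Rightarrow> bool" where
  "chamber_adj A c c' \<longleftrightarrow> card (sep A c c') = 1"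

definition gallery :: "'a::euclidean_space set set \<Rightarrow> 'a set \<Rightarrow> 'a set \<Rightarrow> 'a set list \<Rightarrow> bool" where
  "gallery A c c' r \<longleftrightarrow> r \<noteq> [] \<and> hd r = c \<and> last r = c' \<and> set r \<subseteq> chambers A \<and>
     (\<forall>i. Suc i < length r \<longrightarrow> chamber_adj A (r ! i) (r ! Suc i))"

definition min_gallery :: "'a::euclidean_space set set \<Rightarrow> 'a set \<Rightarrow> 'a set list \<Rightarrow> bool" where
  "min_gallery A c0 r \<longleftrightarrow> gallery A c0 (uminus ` c0) r \<and>
     (\<forall>r'. gallery A c0 (uminus ` c0) r' \<longrightarrow> length r \<le> length r')"

definition crosses_before :: "'a::euclidean_space set set \<Rightarrow> 'a set list \<Rightarrow> 'a set \<Rightarrow> 'a set \<Rightarrow> bool" where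
  "crosses_before A r H H' \<longleftrightarrow> (\<exists>i j. i < j \<and> Suc j < length r \<and>
     H \<in> sep A (r ! i) (r ! Suc i) \<and> H' \<in> sep A (r ! j) (r ! Suc j))"

definition L2_sep :: "'a::euclidean_space set set \<Rightarrow> 'a set list \<Rightarrow> 'a set list \<Rightarrow> 'a set set" where
  "L2_sep A r r' = {X \<in> L_codim A 2. \<exists>H\<in>A. \<exists>H'\<in>A. X \<subseteq> H \<and> X \<subseteq> H' \<and>
       crosses_before A r H H' \<and> crosses_before A r' H' H}"

text \<open>Walks in the graph G_2 and its graph distance (\<infinity> if no walk).\<close>
definition G2_walk :: "'a::euclidean_space set set \<Rightarrow> 'a set \<Rightarrow> 'a set list \<Rightarrow> 'a set list \<Rightarrow> 'a set list list \<Rightarrow> bool" where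
  "G2_walk A c0 r r' ws \<longleftrightarrow> ws \<noteq> [] \<and> hd ws = r \<and> last ws = r' \<and>
     (\<forall>w\<in>set ws. min_gallery A c0 w) \<and>
     (\<forall>i. Suc i < length ws \<longrightarrow> card (L2_sep A (ws ! i) (ws ! Suc i)) = 1)"

definition G2_dist :: "'a::euclidean_space set set \<Rightarrow> 'a set \<Rightarrow> 'a set list \<Rightarrow> 'a set list \<Rightarrow> enat" where
  "G2_dist A c0 r r' = (INF ws \<in> {ws. G2_walk A c0 r r' ws}. enat (length ws - 1))"

definition chamber_incident :: "'a::euclidean_space set \<Rightarrow> 'a set \<Rightarrow> bool" where
  "chamber_incident c X \<longleftrightarrow> aff_dim (closure c \<inter> X) = int (dim X)"

definition chamber_incident_flag :: "(nat \<Rightarrow> 'a::euclidean_space set) \<Rightarrow> 'a set \<Rightarrow> bool" where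
  "chamber_incident_flag F c \<longleftrightarrow> (\<forall>i\<le>DIM('a). chamber_incident c (F i))"

definition gallery_incident_flag :: "'a::euclidean_space set set \<Rightarrow> (nat \<Rightarrow> 'a set) \<Rightarrow> 'a set list \<Rightarrow> bool" where
  "gallery_incident_flag A F r \<longleftrightarrow>
     (\<forall>i j H H'. i < j \<longrightarrow> j \<le> DIM('a) \<longrightarrow> H \<in> A \<longrightarrow> H' \<in> A \<longrightarrow>
        F j \<subseteq> H \<longrightarrow> F i \<subseteq> H' \<longrightarrow> \<not> F j \<subseteq> H' \<longrightarrow> crosses_before A r H H')"

end

theory Submission
  imports Defs
begin

text \<open>
  Orient every hyperplane positively on \<open>c\<^sub>0\<close>. Minimal galleries from \<open>c\<^sub>0\<close> to \<open>-c\<^sub>0\<close> are then the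
  orderings of \<open>A\<close> all of whose prefixes are the negative set of some point. Give \<open>H\<close> the level \<open>i\<close>
  that is least with \<open>F\<^sub>i\<close> not contained in \<open>H\<close>; incidence to \<open>F\<close> says that higher levels are crossed
  first. Choose \<open>w\<^sub>i\<close> in \<open>F\<^sub>i\<close> positive on all hyperplanes not containing \<open>F\<^sub>i\<close>, and normalise the
  linear forms of level \<open>i\<close> to be 1 at \<open>w\<^sub>i\<close>. Modularity says that the difference of two normalised
  forms of equal level is a nonzero multiple of a form of higher level. Hence the order within a level
  is forced as soon as the higher levels come first (uniqueness), and it is the order of the
  normalised values at a point of \<open>c\<^sub>0\<close>, realised by points near \<open>- x\<^sub>0 + s w\<^sub>i\<close> (existence).

  If an order is not graded, let \<open>i\<close> be the least level some member of which precedes a hyperplane of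
  higher level. The order then begins with levels above \<open>i\<close>, followed by a nonempty run \<open>Q\<close> in level
  \<open>i\<close>, followed by some \<open>K\<close> of level above \<open>i\<close>. On the wall \<open>K\<close> being crossed the normalised forms
  are weakly increasing along \<open>Q\<close>, so pushing the wall point in direction \<open>w\<^sub>i\<close> until the last form
  of \<open>Q\<close> vanishes gives a point of a codimension-two flat \<open>X\<close> whose hyperplanes are consecutive
  and end in \<open>K\<close>. Reversing this block is a step of \<open>G\<^sub>2\<close> removing exactly \<open>X\<close> from the
  \<open>L\<^sub>2\<close>-separation from the graded order.
\<close>

section \<open>Precedence in lists\<close>

fun precedes :: "'b list \<Rightarrow> 'b \<Rightarrow> 'b \<Rightarrow> bool" where
  "precedes [] a b \<longleftrightarrow> False"
| "precedes (x # xs) a b \<longleftrightarrow> x = a \<and> b \<in> set xs \<or> precedes xs a b"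

lemma precedes_in_set: "precedes xs a b \<Longrightarrow> a \<in> set xs \<and> b \<in> set xs"
  by (induction xs) auto

lemma precedes_append:
  "precedes (xs @ ys) a b \<longleftrightarrow>
     precedes xs a b \<or> precedes ys a b \<or> a \<in> set xs \<and> b \<in> set ys"
  by (induction xs) auto

lemma precedes_rev: "precedes (rev xs) a b \<longleftrightarrow> precedes xs b a"
  by (induction xs) (auto simp: precedes_append)

lemma precedes_total:
  "a \<in> set xs \<Longrightarrow> b \<in> set xs \<Longrightarrow> a \<noteq> b \<Longrightarrow> precedes xs a b \<or> precedes xs b a"
  by (induction xs) auto

lemma precedes_asym: "distinct xs \<Longrightarrow> precedes xs a b \<Longrightarrow> \<not> precedes xs b a"
  by (induction xs) (auto dest: precedes_in_set)

lemma precedes_irrefl: "distinct xs \<Longrightarrow> \<not> precedes xs a a"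
  using precedes_asym by metis

lemma precedes_split: "precedes xs a b \<Longrightarrow> \<exists>ys zs. xs = ys @ b # zs \<and> a \<in> set ys"
proof (induction xs)
  case (Cons x xs)
  show ?case
  proof (cases "precedes xs a b")
    case True
    with Cons.IH obtain ys zs where "xs = ys @ b # zs" "a \<in> set ys" by blast
    then show ?thesis by (metis append_Cons list.set_intros(2))
  next
    case False
    with Cons.prems have "x = a" "b \<in> set xs" by auto
    then show ?thesis by (metis append_Cons list.set_intros(1) split_list)
  qed
qed simp

lemma precedes_conv_nth:
  "precedes xs a b \<longleftrightarrow> (\<exists>i j. i < j \<and> j < length xs \<and> xs ! i = a \<and> xs ! j = b)"
proof
  assume "precedes xs a b"
  then obtain ys zs where xs: "xs = ys @ b # zs" and a: "a \<in> set ys"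
    using precedes_split by metis
  then obtain i where "i < length ys" "ys ! i = a" by (metis in_set_conv_nth)
  then show "\<exists>i j. i < j \<and> j < length xs \<and> xs ! i = a \<and> xs ! j = b"
    by (intro exI[of _ i] exI[of _ "length ys"]) (simp add: xs nth_append)
next
  assume "\<exists>i j. i < j \<and> j < length xs \<and> xs ! i = a \<and> xs ! j = b"
  then obtain i j where ij: "i < j" "j < length xs" "xs ! i = a" "xs ! j = b" by blast
  have "a \<in> set (take j xs)"
    using ij by (metis in_set_conv_nth length_take min.absorb4 nth_take)
  moreover have "xs = take j xs @ b # drop (Suc j) xs"
    using ij id_take_nth_drop by metis
  ultimately show "precedes xs a b"
    by (metis list.set_intros(1) precedes_append)
qed

text \<open>The head of \<open>xs\<close> precedes everything else, so it must also be the head of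
  \<open>ys\<close>; peel both off and recurse.\<close>

lemma list_eq_if_precedes_eq:
  assumes "distinct xs" "distinct ys" "set xs = set ys"
    and "\<And>a b. precedes xs a b \<Longrightarrow> precedes ys a b"
  shows "xs = ys"
  using assms
proof (induction xs arbitrary: ys)
  case (Cons x xs)
  then obtain y ys' where ys: "ys = y # ys'" by (cases ys) auto
  have "x = y"
  proof (rule ccontr)
    assume "x \<noteq> y"
    then have "precedes (x # xs) x y" using Cons.prems(3) ys by auto
    then have "precedes ys x y" by (rule Cons.prems(4))
    moreover have "precedes ys y x" using \<open>x \<noteq> y\<close> Cons.prems(3) ys by auto
    ultimately show False using precedes_asym Cons.prems(2) by metis
  qed
  have "precedes ys' a b" if "precedes xs a b" for a b
  proof -
    have "precedes ys a b" using Cons.prems(4) that by simp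
    moreover have "a \<noteq> x" using Cons.prems(1) precedes_in_set[OF that] by auto
    ultimately show ?thesis using ys \<open>x = y\<close> by simp
  qed
  moreover have "set xs = set ys'" "distinct xs" "distinct ys'"
    using Cons.prems(1-3) ys \<open>x = y\<close> by auto
  ultimately have "xs = ys'" using Cons.IH by blast
  then show ?case using ys \<open>x = y\<close> by simp
qed simp

lemma precedes_rev_block:
  assumes "distinct (P @ B @ R)"
  shows "precedes (P @ rev B @ R) a b \<longleftrightarrow>
    (if a \<in> set B \<and> b \<in> set B then precedes (P @ B @ R) b a else precedes (P @ B @ R) a b)"
  using assms by (auto simp: precedes_append precedes_rev dest: precedes_in_set)

text \<open>Insertion sort: the new element goes after everything related to it and before the rest.
  Since \<open>r\<close> is not assumed antisymmetric, ties may fall either way.\<close>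

lemma ex_distinct_list_precedes:
  assumes "finite A"
    and tot: "\<And>a b. a \<in> A \<Longrightarrow> b \<in> A \<Longrightarrow> a \<noteq> b \<Longrightarrow> r a b \<or> r b a"
    and tr: "\<And>a b c. a \<in> A \<Longrightarrow> b \<in> A \<Longrightarrow> c \<in> A \<Longrightarrow> r a b \<Longrightarrow> r b c \<Longrightarrow> r a c"
  shows "\<exists>xs. distinct xs \<and> set xs = A \<and> (\<forall>a b. precedes xs a b \<longrightarrow> r a b)"
  using assms
proof (induction A rule: finite_induct)
  case empty
  show ?case by (rule exI[of _ "[]"]) simp
next
  case (insert x A)
  have "\<exists>xs. distinct xs \<and> set xs = A \<and> (\<forall>a b. precedes xs a b \<longrightarrow> r a b)"
    by (rule insert.IH) (use insert.prems in blast)+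
  then obtain xs where xs: "distinct xs" "set xs = A" "\<And>a b. precedes xs a b \<Longrightarrow> r a b"
    by blast
  let ?l = "filter (\<lambda>y. r y x) xs" and ?g = "filter (\<lambda>y. \<not> r y x) xs"
  have f: "precedes (filter Q zs) a b \<Longrightarrow> precedes zs a b" for Q zs a b
    by (induction zs) (auto split: if_splits)
  have "r a b" if ab: "precedes (?l @ x # ?g) a b" for a b
  proof -
    consider "precedes xs a b" | "a \<in> A" "r a x" "b = x" | "a = x" "b \<in> A" "\<not> r b x"
      | "a \<in> A" "r a x" "b \<in> A" "\<not> r b x"
      using ab xs(2) f[of "\<lambda>y. r y x" xs a b] f[of "\<lambda>y. \<not> r y x" xs a b]
      by (auto simp: precedes_append)
    then show ?thesis
    proof cases
      case 1
      then show ?thesis by (rule xs(3))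
    next
      case 3
      then show ?thesis using insert.prems(1)[of x b] insert.hyps(2) by blast
    next
      case 4
      then have "r x b" using insert.prems(1)[of x b] insert.hyps(2) by blast
      then show ?thesis using insert.prems(2)[of a x b] 4 by blast
    qed simp
  qed
  moreover have "distinct (?l @ x # ?g)" "set (?l @ x # ?g) = insert x A"
    using xs insert.hyps by auto
  ultimately show ?case by blast
qed

section \<open>Chambers as sign vectors\<close>

text \<open>Take \<open>x + e *\<^sub>R y\<close> with small \<open>e > 0\<close>; finiteness of
  \<open>A\<close> allows one \<open>e\<close> for all hyperplanes. This is the composition of sign
  vectors known from oriented matroids.\<close>

lemma perturbed_signs:
  fixes n :: "'b \<Rightarrow> 'a::euclidean_space"
  assumes "finite A"
  shows "\<exists>z. \<forall>H\<in>A. sgn (n H \<bullet> z) = (if n H \<bullet> x \<noteq> 0 then sgn (n H \<bullet> x) else sgn (n H \<bullet> y))"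
proof -
  have "\<forall>\<^sub>F e in at_right (0::real). sgn (n H \<bullet> (x + e *\<^sub>R y)) =
      (if n H \<bullet> x \<noteq> 0 then sgn (n H \<bullet> x) else sgn (n H \<bullet> y))" for H
  proof -
    have lim: "((\<lambda>e. n H \<bullet> (x + e *\<^sub>R y)) \<longlongrightarrow> n H \<bullet> (x + 0 *\<^sub>R y)) (at_right (0::real))"
      by (intro tendsto_intros)
    consider "n H \<bullet> x > 0" | "n H \<bullet> x < 0" | "n H \<bullet> x = 0" by linarith
    then show ?thesis
    proof cases
      case 1
      with order_tendstoD(1)[OF lim, of 0] show ?thesis
        by (auto elim!: eventually_mono)
    next
      case 2
      with order_tendstoD(2)[OF lim, of 0] show ?thesis
        by (auto elim!: eventually_mono)
    next
      case 3
      have "\<forall>\<^sub>F e in at_right (0::real). e > 0" by (rule eventually_at_right_less)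
      then show ?thesis
        by eventually_elim (simp add: 3 inner_add_right sgn_mult)
    qed
  qed
  then have "\<forall>\<^sub>F e in at_right (0::real). \<forall>H\<in>A. sgn (n H \<bullet> (x + e *\<^sub>R y)) =
      (if n H \<bullet> x \<noteq> 0 then sgn (n H \<bullet> x) else sgn (n H \<bullet> y))"
    using assms by (intro eventually_ball_finite) auto
  from eventually_happens'[OF trivial_limit_at_right_real this] show ?thesis by blast
qed

text \<open>A chamber will be encoded by the set of hyperplanes separating it from the base chamber;
  with all normals positive there, this is the set of its negative signs.\<close>

locale oriented_arrangement =
  fixes A :: "'a::euclidean_space set set" and n :: "'a set \<Rightarrow> 'a"
  assumes finite_A: "finite A"
    and normal_nonzero: "H \<in> A \<Longrightarrow> n H \<noteq> 0"
    and hyperplane_eq: "H \<in> A \<Longrightarrow> H = {x. n H \<bullet> x = 0}"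
    and base_point: "\<exists>x. \<forall>H\<in>A. n H \<bullet> x > 0"
begin

text \<open>Not every \<open>S\<close> is realisable: the region may be empty, hence the
  nonemptiness conditions below.\<close>

definition region :: "'a set set \<Rightarrow> 'a set" where
  "region S = {x. \<forall>H\<in>A. if H \<in> S then n H \<bullet> x < 0 else n H \<bullet> x > 0}"

lemma mem_hyperplane_iff: "H \<in> A \<Longrightarrow> x \<in> H \<longleftrightarrow> n H \<bullet> x = 0"
  using hyperplane_eq by blast

lemma regionD:
  assumes "x \<in> region S" "H \<in> A"
  shows "H \<in> S \<Longrightarrow> n H \<bullet> x < 0" "H \<notin> S \<Longrightarrow> n H \<bullet> x > 0"
  using assms by (auto simp: region_def split: if_splits)

lemma convex_region: "convex (region S)"
proof -
  have "region S = (\<Inter>H\<in>A. if H \<in> S then {x. n H \<bullet> x < 0} else {x. n H \<bullet> x > 0})"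
    by (auto simp: region_def split: if_splits)
  also have "convex \<dots>"
    by (intro convex_INT) (auto simp: convex_halfspace_lt convex_halfspace_gt)
  finally show ?thesis .
qed

lemma region_subset: "region S \<subseteq> - \<Union>A"
proof
  fix x assume x: "x \<in> region S"
  have "x \<notin> H" if "H \<in> A" for H
    using regionD[OF x that] mem_hyperplane_iff[OF that] by fastforce
  then show "x \<in> - \<Union>A" by blast
qed

lemma region_inject:
  assumes "S \<subseteq> A" "S' \<subseteq> A" "region S \<noteq> {}" "region S = region S'"
  shows "S = S'"
proof -
  obtain x where x: "x \<in> region S" "x \<in> region S'" using assms by auto
  have "H \<in> S \<longleftrightarrow> H \<in> S'" if "H \<in> A" for H
    using regionD[OF x(1) that] regionD[OF x(2) that] by fastforce
  then show ?thesis using assms by blast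
qed

lemma connected_same_sign:
  assumes "connected T" "T \<subseteq> - H" "H \<in> A" "x \<in> T" "y \<in> T" "n H \<bullet> x < 0"
  shows "n H \<bullet> y < 0"
proof (rule ccontr)
  assume "\<not> n H \<bullet> y < 0"
  then obtain z where "z \<in> T" "n H \<bullet> z = 0"
    using connected_ivt_hyperplane[of T x y "n H" 0] assms by force
  then show False using assms mem_hyperplane_iff by blast
qed

text \<open>The region is convex, hence connected, and avoids all of \<open>A\<close>, so it fits
  into the component; conversely a connected set avoiding \<open>H\<close> cannot change its sign on
  \<open>n H\<close>.\<close>

lemma component_eq_region:
  assumes c: "c \<in> components (- \<Union>A)" and x: "x \<in> c"
  shows "c = region {H \<in> A. n H \<bullet> x < 0}"
proof -
  let ?S = "{H \<in> A. n H \<bullet> x < 0}"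
  have sub: "c \<subseteq> - \<Union>A" and con: "connected c"
    using c in_components_subset in_components_connected by auto
  have xr: "x \<in> region ?S"
    using sub x by (auto simp: region_def mem_hyperplane_iff)
      (metis linorder_neqE_linordered_idom mem_hyperplane_iff subsetD UnionI ComplD)
  have "region ?S \<subseteq> c"
    using components_maximal[OF c convex_connected[OF convex_region] region_subset] x xr by blast
  moreover have "c \<subseteq> region ?S"
  proof
    fix y assume y: "y \<in> c"
    have "if H \<in> ?S then n H \<bullet> y < 0 else n H \<bullet> y > 0" if H: "H \<in> A" for H
    proof -
      have cH: "c \<subseteq> - H" using sub H by blast
      have "n H \<bullet> y \<noteq> 0" using cH y mem_hyperplane_iff[OF H] by blast
      moreover have "n H \<bullet> y < 0 \<longleftrightarrow> n H \<bullet> x < 0"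
        using connected_same_sign[OF con cH H] x y by blast
      ultimately show ?thesis using H by auto
    qed
    then show "y \<in> region ?S" by (auto simp: region_def)
  qed
  ultimately show ?thesis by blast
qed

lemma chambers_eq: "chambers A = {region S | S. S \<subseteq> A \<and> region S \<noteq> {}}"
proof (intro equalityI subsetI)
  fix c assume "c \<in> chambers A"
  then have c: "c \<in> components (- \<Union>A)" by (simp add: chambers_def)
  then obtain x where "x \<in> c" using in_components_nonempty by blast
  from component_eq_region[OF c this] this
  show "c \<in> {region S | S. S \<subseteq> A \<and> region S \<noteq> {}}" by blast
next
  fix c assume "c \<in> {region S | S. S \<subseteq> A \<and> region S \<noteq> {}}"
  then obtain S x where S: "c = region S" "S \<subseteq> A" "x \<in> region S" by blast
  let ?c = "connected_component_set (- \<Union>A) x"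
  have x: "x \<in> - \<Union>A" using S(3) region_subset by blast
  then have "?c \<in> components (- \<Union>A)" "x \<in> ?c" by (auto simp: components_def)
  then have "?c = region {H \<in> A. n H \<bullet> x < 0}" by (rule component_eq_region)
  also have "{H \<in> A. n H \<bullet> x < 0} = S"
    using S regionD[OF S(3)] by (auto, metis less_asym)
  finally show "c \<in> chambers A"
    using S x by (auto simp: chambers_def components_def)
qed

text \<open>The complement of one \<open>H\<close> consists of two open half-spaces: convexity joins
  points on the same side, and \<open>connected_same_sign\<close> keeps opposite sides
  apart.\<close>

lemma sep_regions:
  assumes "S \<subseteq> A" "S' \<subseteq> A" "region S \<noteq> {}" "region S' \<noteq> {}"
  shows "sep A (region S) (region S') = (S - S') \<union> (S' - S)"
proof -
  have "(\<forall>x\<in>region S. \<forall>y\<in>region S'. \<not> connected_component (- H) x y) \<longleftrightarrow>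
      \<not> (H \<in> S \<longleftrightarrow> H \<in> S')" if H: "H \<in> A" for H
  proof
    assume *: "\<forall>x\<in>region S. \<forall>y\<in>region S'. \<not> connected_component (- H) x y"
    obtain x y where xy: "x \<in> region S" "y \<in> region S'" using assms by blast
    show "\<not> (H \<in> S \<longleftrightarrow> H \<in> S')"
    proof
      assume same: "H \<in> S \<longleftrightarrow> H \<in> S'"
      let ?T = "if H \<in> S then {x. n H \<bullet> x < 0} else {x. n H \<bullet> x > 0}"
      have "connected ?T"
        by (auto intro: convex_connected simp: convex_halfspace_lt convex_halfspace_gt)
      moreover have "?T \<subseteq> - H" using mem_hyperplane_iff[OF H] by auto
      moreover have "x \<in> ?T" "y \<in> ?T"
        using regionD[OF xy(1) H] regionD[OF xy(2) H] same by auto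
      ultimately have "connected_component (- H) x y"
        unfolding connected_component_def by blast
      with * xy show False by blast
    qed
  next
    assume *: "\<not> (H \<in> S \<longleftrightarrow> H \<in> S')"
    show "\<forall>x\<in>region S. \<forall>y\<in>region S'. \<not> connected_component (- H) x y"
    proof (intro ballI notI)
      fix x y assume xy: "x \<in> region S" "y \<in> region S'" "connected_component (- H) x y"
      then obtain T where T: "connected T" "T \<subseteq> - H" "x \<in> T" "y \<in> T"
        unfolding connected_component_def by blast
      have "n H \<bullet> x < 0 \<longleftrightarrow> n H \<bullet> y < 0"
        using connected_same_sign[OF T(1,2) H] T by blast
      then show False
        using regionD[OF xy(1) H] regionD[OF xy(2) H] * by fastforce
    qed
  qed
  then show ?thesis using assms by (auto simp: sep_def)
qed

lemma uminus_region_base: "uminus ` region {} = region A"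
proof -
  have "x \<in> uminus ` region {}" if "x \<in> region A" for x
  proof -
    have "- x \<in> region {}" using that by (auto simp: region_def)
    then show ?thesis by (metis image_eqI minus_minus)
  qed
  moreover have "uminus ` region {} \<subseteq> region A" by (auto simp: region_def)
  ultimately show ?thesis by blast
qed

section \<open>Minimal galleries as crossing orders\<close>

text \<open>The prefix condition says that every intermediate sign vector is a chamber; the empty
  prefix gives the base chamber and the full list its antipode.\<close>

definition crossing_order :: "'a set list \<Rightarrow> bool" where
  "crossing_order hs \<longleftrightarrow> distinct hs \<and> set hs = A \<and>
     (\<forall>P R. hs = P @ R \<longrightarrow> region (set P) \<noteq> {})"

definition gallery_of :: "'a set list \<Rightarrow> 'a set list" where
  "gallery_of hs = map (\<lambda>k. region (set (take k hs))) [0..<Suc (length hs)]"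

lemma crossing_orderD:
  assumes "crossing_order hs"
  shows "distinct hs" "set hs = A" "hs = P @ R \<Longrightarrow> region (set P) \<noteq> {}"
  using assms by (auto simp: crossing_order_def)

lemma length_crossing_order: "crossing_order hs \<Longrightarrow> length hs = card A"
  using crossing_orderD distinct_card by metis

lemma region_take_nonempty: "crossing_order hs \<Longrightarrow> region (set (take k hs)) \<noteq> {}"
  by (metis append_take_drop_id crossing_orderD(3))

lemma length_gallery_of [simp]: "length (gallery_of hs) = Suc (length hs)"
  by (simp add: gallery_of_def)

lemma nth_gallery_of: "k \<le> length hs \<Longrightarrow> gallery_of hs ! k = region (set (take k hs))"
  unfolding gallery_of_def by (subst nth_map) (auto simp del: upt_Suc)

lemma sep_gallery_of:
  assumes hs: "crossing_order hs" and k: "k < length hs"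
  shows "sep A (gallery_of hs ! k) (gallery_of hs ! Suc k) = {hs ! k}"
proof -
  have eq: "set (take (Suc k) hs) = insert (hs ! k) (set (take k hs))"
    using k by (simp add: take_Suc_conv_app_nth)
  have "distinct (take (Suc k) hs)" using crossing_orderD(1)[OF hs] by simp
  then have "hs ! k \<notin> set (take k hs)" using k by (simp add: take_Suc_conv_app_nth)
  moreover have "set (take k hs) \<subseteq> A" "set (take (Suc k) hs) \<subseteq> A"
    using set_take_subset[of k hs] set_take_subset[of "Suc k" hs] crossing_orderD(2)[OF hs]
    by simp_all
  ultimately have "sep A (region (set (take k hs))) (region (set (take (Suc k) hs))) = {hs ! k}"
    using sep_regions[OF _ _ region_take_nonempty[OF hs] region_take_nonempty[OF hs], of k "Suc k"]
    unfolding eq by auto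
  then show ?thesis using k by (simp add: nth_gallery_of)
qed

lemma gallery_gallery_of:
  assumes hs: "crossing_order hs"
  shows "gallery A (region {}) (region A) (gallery_of hs)"
proof -
  have ne: "gallery_of hs \<noteq> []" by (metis length_gallery_of list.size(3) nat.distinct(1))
  have "hd (gallery_of hs) = region {}"
    using nth_gallery_of[of 0 hs] ne by (simp add: hd_conv_nth)
  moreover have "last (gallery_of hs) = region A"
    using nth_gallery_of[of "length hs" hs] ne crossing_orderD(2)[OF hs] by (simp add: last_conv_nth)
  moreover have "set (gallery_of hs) \<subseteq> chambers A"
  proof -
    have "region (set (take k hs)) \<in> chambers A" for k
      using region_take_nonempty[OF hs] crossing_orderD(2)[OF hs] set_take_subset[of k hs]
      unfolding chambers_eq by blast
    then show ?thesis unfolding gallery_of_def by (auto simp del: upt_Suc)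
  qed
  ultimately show ?thesis
    using ne sep_gallery_of[OF hs] by (auto simp: gallery_def chamber_adj_def)
qed

lemma gallery_sign_sets:
  assumes r: "gallery A (region {}) (region A) r"
  obtains S where "\<And>k. k < length r \<Longrightarrow> S k \<subseteq> A \<and> region (S k) \<noteq> {} \<and> r ! k = region (S k)"
    "S 0 = {}" "S (length r - 1) = A"
    "\<And>k. Suc k < length r \<Longrightarrow> card ((S k - S (Suc k)) \<union> (S (Suc k) - S k)) = 1"
proof -
  have r': "r \<noteq> []" "hd r = region {}" "last r = region A" "set r \<subseteq> chambers A"
    "\<And>i. Suc i < length r \<Longrightarrow> chamber_adj A (r ! i) (r ! Suc i)"
    using r by (auto simp: gallery_def)
  have "\<forall>k. \<exists>S. k < length r \<longrightarrow> S \<subseteq> A \<and> region S \<noteq> {} \<and> r ! k = region S"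
  proof
    fix k
    show "\<exists>S. k < length r \<longrightarrow> S \<subseteq> A \<and> region S \<noteq> {} \<and> r ! k = region S"
    proof (cases "k < length r")
      case True
      then have "r ! k \<in> chambers A" using r'(4) nth_mem by blast
      then show ?thesis unfolding chambers_eq by blast
    qed simp
  qed
  then obtain S where S: "\<And>k. k < length r \<Longrightarrow> S k \<subseteq> A \<and> region (S k) \<noteq> {} \<and> r ! k = region (S k)"
    by metis
  have "S 0 = {}"
    using S[of 0] r'(1,2) region_inject[of "S 0" "{}"] by (simp add: hd_conv_nth)
  moreover have "S (length r - 1) = A"
    using S[of "length r - 1"] r'(1,3) region_inject[of "S (length r - 1)" A] by (simp add: last_conv_nth)
  moreover have "card ((S k - S (Suc k)) \<union> (S (Suc k) - S k)) = 1" if "Suc k < length r" for k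
    using r'(5)[OF that] S[OF that] S[of k] that sep_regions[of "S k" "S (Suc k)"]
    by (simp add: chamber_adj_def)
  ultimately show ?thesis using S that by blast
qed

lemma card_le_if_symdiff_1:
  assumes "card ((S - T) \<union> (T - S)) = 1" "finite S" "finite T"
  shows "card T \<le> Suc (card S)"
proof -
  have "T \<subseteq> S \<union> ((S - T) \<union> (T - S))" by blast
  then have "card T \<le> card (S \<union> ((S - T) \<union> (T - S)))"
    using assms by (intro card_mono) auto
  also have "\<dots> \<le> card S + 1" using card_Un_le[of S "(S - T) \<union> (T - S)"] assms(1) by simp
  finally show ?thesis by simp
qed

lemma gallery_steps_card:
  fixes S :: "nat \<Rightarrow> 'a set set"
  assumes "\<And>k. k \<le> m \<Longrightarrow> S k \<subseteq> A"
    and "\<And>k. k < m \<Longrightarrow> card ((S k - S (Suc k)) \<union> (S (Suc k) - S k)) = 1"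
    and "i \<le> j" "j \<le> m"
  shows "card (S j) \<le> card (S i) + (j - i)"
  using assms(3,4)
proof (induction j rule: dec_induct)
  case (step j)
  have "finite (S j)" "finite (S (Suc j))"
    using assms(1) step.prems finite_A by (meson Suc_leD rev_finite_subset)+
  then have "card (S (Suc j)) \<le> Suc (card (S j))"
    using card_le_if_symdiff_1 assms(2)[of j] step.prems by simp
  then show ?case using step by simp
qed simp

text \<open>The sign sets run from \<open>{}\<close> to \<open>A\<close> and gain at most one
  element per step.\<close>

lemma gallery_length_ge:
  assumes "gallery A (region {}) (region A) r"
  shows "Suc (card A) \<le> length r"
proof -
  obtain S where S: "\<And>k. k < length r \<Longrightarrow> S k \<subseteq> A \<and> region (S k) \<noteq> {} \<and> r ! k = region (S k)"
    "S 0 = {}" "S (length r - 1) = A"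
    "\<And>k. Suc k < length r \<Longrightarrow> card ((S k - S (Suc k)) \<union> (S (Suc k) - S k)) = 1"
    using gallery_sign_sets[OF assms] by metis
  have ne: "length r > 0" using assms by (auto simp: gallery_def)
  have "card (S (length r - 1)) \<le> card (S 0) + (length r - 1 - 0)"
  proof (rule gallery_steps_card)
    show "S k \<subseteq> A" if "k \<le> length r - 1" for k
      using S(1)[of k] that ne by linarith
    show "card ((S k - S (Suc k)) \<union> (S (Suc k) - S k)) = 1" if "k < length r - 1" for k
      using S(4)[of k] that by linarith
  qed simp_all
  then have "card A \<le> length r - 1" using S(2,3) by simp
  then show ?thesis using ne by linarith
qed

text \<open>With only \<open>card A\<close> steps, none can be spent on losing a hyperplane. Each
  step therefore gains exactly one, and the gains in sequence form the crossing order.\<close>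

lemma short_gallery_crossing_order:
  assumes r: "gallery A (region {}) (region A) r" and len: "length r = Suc (card A)"
  shows "\<exists>hs. crossing_order hs \<and> r = gallery_of hs"
proof -
  define m where "m = card A"
  obtain S where S: "\<And>k. k < length r \<Longrightarrow> S k \<subseteq> A \<and> region (S k) \<noteq> {} \<and> r ! k = region (S k)"
    "S 0 = {}" "S (length r - 1) = A"
    "\<And>k. Suc k < length r \<Longrightarrow> card ((S k - S (Suc k)) \<union> (S (Suc k) - S k)) = 1"
    using gallery_sign_sets[OF r] by metis
  have Sm: "S m = A" using S(3) len m_def by simp
  have sub: "S k \<subseteq> A" if "k \<le> m" for k using S(1) that len m_def by auto
  have fin: "finite (S k)" if "k \<le> m" for k using sub[OF that] finite_A finite_subset by blast
  have adj: "card ((S k - S (Suc k)) \<union> (S (Suc k) - S k)) = 1" if "k < m" for k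
    using S(4) that len m_def by auto
  have steps: "card (S j) \<le> card (S i) + (j - i)" if "i \<le> j" "j \<le> m" for i j
    using gallery_steps_card[of m S i j] sub adj that by blast
  \<comment> \<open>Counting from the start gives at most \<open>k\<close> elements; counting
    towards the end, where all \<open>m\<close> hyperplanes are present, gives at least
    \<open>k\<close>.\<close>
  have cardS: "card (S k) = k" if "k \<le> m" for k
    using steps[of 0 k] steps[of k m] that S(2) Sm m_def by simp
  have "\<exists>h. S (Suc k) = insert h (S k) \<and> h \<notin> S k" if k: "k < m" for k
  proof -
    have "finite (S k)" "finite (S (Suc k))" "card (S k) = k" "card (S (Suc k)) = Suc k"
      using k fin cardS by simp_all
    moreover obtain h where h: "(S k - S (Suc k)) \<union> (S (Suc k) - S k) = {h}"
      using adj[OF k] by (auto simp: card_1_singleton_iff)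
    ultimately have "\<not> S (Suc k) \<subseteq> S k"
      by (metis card_mono Suc_n_not_le_n)
    then obtain g where g: "g \<in> S (Suc k)" "g \<notin> S k" by (meson subsetI)
    have *: "a \<in> S k \<and> a \<notin> S (Suc k) \<or> a \<in> S (Suc k) \<and> a \<notin> S k \<longleftrightarrow> a = h" for a
      using h by (simp add: set_eq_iff)
    then have "S (Suc k) = insert g (S k)" using g by (metis insert_iff set_eqI)
    with g show ?thesis by meson
  qed
  then obtain h where h: "\<And>k. k < m \<Longrightarrow> S (Suc k) = insert (h k) (S k) \<and> h k \<notin> S k" by metis
  define hs where "hs = map h [0..<m]"
  have len_hs: "length hs = m" by (simp add: hs_def)
  have tk: "set (take k hs) = S k" if "k \<le> m" for k
    using that
  proof (induction k)
    case (Suc k)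
    then have "set (take (Suc k) hs) = insert (h k) (set (take k hs))"
      using len_hs by (simp add: take_Suc_conv_app_nth hs_def)
    then show ?case using Suc h[of k] by simp
  qed (simp add: S(2))
  have set_hs: "set hs = A" using tk[of m] len_hs Sm by simp
  have "distinct hs" using set_hs len_hs m_def by (simp add: card_distinct)
  moreover have "region (set P) \<noteq> {}" if "hs = P @ R" for P R
  proof -
    have "length P \<le> m" "P = take (length P) hs" using that len_hs by auto
    then have "set P = S (length P)" using tk by metis
    then show ?thesis using S(1)[of "length P"] \<open>length P \<le> m\<close> len m_def by simp
  qed
  ultimately have "crossing_order hs" using set_hs by (simp add: crossing_order_def)
  moreover have "r = gallery_of hs"
  proof (rule nth_equalityI)
    show "length r = length (gallery_of hs)" using len len_hs m_def by simp
    fix k assume "k < length r"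
    then have "k \<le> m" using len m_def by simp
    then show "r ! k = gallery_of hs ! k"
      using S(1)[of k] \<open>k < length r\<close> tk len_hs by (simp add: nth_gallery_of)
  qed
  ultimately show ?thesis by blast
qed

text \<open>The order \<open>hs0\<close> provides a gallery of \<open>Suc (card A)\<close> chambers,
  so the bound of \<open>gallery_length_ge\<close> is attained. For modular flags
  \<open>ex_graded_order\<close> supplies such an order.\<close>

lemma min_gallery_iff:
  assumes "crossing_order hs0"
  shows "min_gallery A (region {}) r \<longleftrightarrow> (\<exists>hs. crossing_order hs \<and> r = gallery_of hs)"
proof
  assume r: "min_gallery A (region {}) r"
  then have g: "gallery A (region {}) (region A) r"
    and "length r \<le> length (gallery_of hs0)"
    using gallery_gallery_of[OF assms] by (auto simp: min_gallery_def uminus_region_base)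
  then have "length r = Suc (card A)"
    using gallery_length_ge[OF g] length_crossing_order[OF assms] by simp
  then show "\<exists>hs. crossing_order hs \<and> r = gallery_of hs"
    using short_gallery_crossing_order g by blast
next
  assume "\<exists>hs. crossing_order hs \<and> r = gallery_of hs"
  then show "min_gallery A (region {}) r"
    using gallery_gallery_of gallery_length_ge length_crossing_order
    by (auto simp: min_gallery_def uminus_region_base)
qed

lemma crosses_before_gallery_of:
  assumes "crossing_order hs"
  shows "crosses_before A (gallery_of hs) G H \<longleftrightarrow> precedes hs G H"
proof -
  have "crosses_before A (gallery_of hs) G H \<longleftrightarrow>
      (\<exists>i j. i < j \<and> j < length hs \<and> G = hs ! i \<and> H = hs ! j)"
    unfolding crosses_before_def
    by (intro ex_cong1) (auto simp: sep_gallery_of[OF assms])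
  then show ?thesis by (auto simp: precedes_conv_nth)
qed

text \<open>The point is taken from the chamber in which \<open>H\<close> is the next hyperplane to
  be crossed.\<close>

lemma separating_point:
  assumes hs: "crossing_order hs" and GH: "precedes hs G H"
  obtains x where "n G \<bullet> x < 0" "n H \<bullet> x > 0" "\<And>M. precedes hs M H \<Longrightarrow> n M \<bullet> x < 0"
proof -
  obtain P R where split: "hs = P @ H # R" "G \<in> set P" using precedes_split[OF GH] by blast
  then obtain x where x: "x \<in> region (set P)" using crossing_orderD(3)[OF hs] by blast
  have d: "distinct hs" "set hs = A" using crossing_orderD[OF hs] by auto
  have "n M \<bullet> x < 0" if "precedes hs M H" for M
  proof -
    have "M \<in> set P"
      using that d(1) split by (auto simp: precedes_append dest: precedes_in_set)
    then show ?thesis using regionD(1)[OF x] d split by auto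
  qed
  moreover have "n H \<bullet> x > 0" using regionD(2)[OF x, of H] d split by auto
  ultimately show ?thesis using that GH by blast
qed

text \<open>Exactly the hyperplanes of \<open>B\<close> pass through \<open>z\<close>. Reversing
  \<open>B\<close> means going round \<open>z\<close> on the other side, through the local antipodes
  of the original intermediate chambers.\<close>

lemma crossing_order_flip:
  assumes hs: "crossing_order (P @ B @ R)"
    and z: "\<And>G. G \<in> set P \<Longrightarrow> n G \<bullet> z < 0" "\<And>G. G \<in> set B \<Longrightarrow> n G \<bullet> z = 0"
      "\<And>G. G \<in> set R \<Longrightarrow> n G \<bullet> z > 0"
  shows "crossing_order (P @ rev B @ R)"
proof -
  have d: "distinct (P @ B @ R)" "set (P @ B @ R) = A" using crossing_orderD[OF hs] by auto
  have "region (set P') \<noteq> {}" if eq: "P @ rev B @ R = P' @ R'" for P' R'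
  proof -
    consider (P) U where "P = P' @ U" | (R) U where "P' = P @ rev B @ U" "R = U @ R'"
      | (B) U V where "P' = P @ U" "rev B = U @ V"
      using eq by (auto simp: append_eq_append_conv2)
    then show ?thesis
    proof cases
      case P
      then show ?thesis using crossing_orderD(3)[OF hs, of P' "U @ B @ R"] by simp
    next
      case R
      then show ?thesis using crossing_orderD(3)[OF hs, of "P @ B @ U" R'] by simp
    next
      case B
      then have B': "B = rev V @ rev U" by (metis rev_append rev_rev_ident)
      then obtain x where x: "x \<in> region (set (P @ V))"
        using crossing_orderD(3)[OF hs, of "P @ rev V" "rev U @ R"] by auto
      \<comment> \<open>At \<open>- x\<close> the forms of \<open>U\<close> are negative and those
        of \<open>V\<close> positive, as the prefix \<open>P @ U\<close> requires; \<open>z\<close>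
        fixes the signs on \<open>P\<close> and \<open>R\<close>.\<close>
      obtain y where y: "\<forall>H\<in>A. sgn (n H \<bullet> y) =
          (if n H \<bullet> z \<noteq> 0 then sgn (n H \<bullet> z) else sgn (n H \<bullet> (- x)))"
        using perturbed_signs[OF finite_A] by blast
      have "if H \<in> set P' then n H \<bullet> y < 0 else n H \<bullet> y > 0" if H: "H \<in> A" for H
      proof -
        note s = y[rule_format, OF H]
        consider "H \<in> set P" | "H \<in> set U" | "H \<in> set V" | "H \<in> set R"
          using H d(2) B' by auto
        then show ?thesis
        proof cases
          case 1
          then show ?thesis using s z(1)[OF 1] B(1) by (simp add: sgn_if split: if_splits)
        next
          case 2
          moreover have "n H \<bullet> x > 0" using regionD(2)[OF x H] 2 d(1) B' by auto
          ultimately show ?thesis using s z(2)[of H] B(1) B' by (auto simp: sgn_if split: if_splits)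
        next
          case 3
          moreover have "n H \<bullet> x < 0" using regionD(1)[OF x H] 3 by auto
          moreover have "H \<notin> set P'" using 3 d(1) B(1) B' by auto
          ultimately show ?thesis using s z(2)[of H] B' by (auto simp: sgn_if split: if_splits)
        next
          case 4
          moreover have "H \<notin> set P'" using 4 d(1) B(1) B' by auto
          ultimately show ?thesis using s z(3)[OF 4] by (simp add: sgn_if split: if_splits)
        qed
      qed
      then have "y \<in> region (set P')" by (simp add: region_def)
      then show ?thesis by blast
    qed
  qed
  then show ?thesis using d by (auto simp: crossing_order_def)
qed

section \<open>Codimension two\<close>

lemma subspace_hyperplane_mem: "H \<in> A \<Longrightarrow> subspace H"
  by (subst hyperplane_eq) (auto intro: subspace_hyperplane)

lemma subspace_intersections: "X \<in> intersections A \<Longrightarrow> subspace X"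
  unfolding intersections_def by (auto intro!: subspace_Inter intro: subspace_hyperplane_mem)

lemma dim_hyperplane_mem: "H \<in> A \<Longrightarrow> dim H = DIM('a) - 1"
  using arg_cong[OF hyperplane_eq, of H dim] dim_hyperplane[OF normal_nonzero, of H] by argo

lemma finite_L_codim: "finite (L_codim A k)"
proof -
  have "intersections A = Inter ` Pow A" by (auto simp: intersections_def)
  then show ?thesis using finite_A by (simp add: L_codim_def)
qed

lemma Int_psubset:
  assumes "G \<in> A" "H \<in> A" "G \<noteq> H"
  shows "G \<inter> H \<subset> G"
proof -
  have "\<not> G \<subseteq> H"
  proof
    assume "G \<subseteq> H"
    then have "G = H"
      using subspace_dim_equal[of G H] subspace_hyperplane_mem dim_hyperplane_mem assms by simp
    then show False using assms by simp
  qed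
  then show ?thesis by blast
qed

lemma dim_Int:
  assumes "G \<in> A" "H \<in> A" "G \<noteq> H"
  shows "dim (G \<inter> H) + 2 = DIM('a)"
proof -
  have s: "subspace G" "subspace H" "subspace (G \<inter> H)"
    using assms subspace_hyperplane_mem subspace_inter by auto
  have "dim (G \<inter> H) < dim G"
    using dim_psubset[of "G \<inter> H" G] Int_psubset[OF assms] s span_eq_iff by metis
  moreover have "dim {x + y |x y. x \<in> G \<and> y \<in> H} + dim (G \<inter> H) = dim G + dim H"
    using dim_sums_Int s by blast
  moreover have "dim {x + y |x y. x \<in> G \<and> y \<in> H} \<le> DIM('a)" by (rule dim_subset_UNIV)
  ultimately show ?thesis using dim_hyperplane_mem assms DIM_positive[where 'a='a] by simp
qed

lemma Int_in_L_codim: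
  assumes "G \<in> A" "H \<in> A" "G \<noteq> H"
  shows "G \<inter> H \<in> L_codim A 2"
proof -
  have "G \<inter> H = \<Inter>{G, H}" "{G, H} \<subseteq> A" using assms by auto
  then have "G \<inter> H \<in> intersections A" unfolding intersections_def by blast
  then show ?thesis using dim_Int[OF assms] by (simp add: L_codim_def)
qed

text \<open>The dimensions agree. Hence two hyperplanes share only one flat of codimension two,
  which confines the effect of a block reversal to a single flat.\<close>

lemma L_codim_2_eq_Int:
  assumes "X \<in> L_codim A 2" "G \<in> A" "H \<in> A" "G \<noteq> H" "X \<subseteq> G" "X \<subseteq> H"
  shows "X = G \<inter> H"
proof (rule subspace_dim_equal)
  show "subspace X" using assms(1) subspace_intersections by (simp add: L_codim_def)
  show "subspace (G \<inter> H)" using assms subspace_hyperplane_mem subspace_inter by blast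
  show "X \<subseteq> G \<inter> H" using assms by blast
  show "dim (G \<inter> H) \<le> dim X"
    using dim_Int[OF assms(2-4)] assms(1) by (simp add: L_codim_def)
qed

section \<open>Separation sets and the lower bound for distances\<close>

lemma mem_L2_sep:
  assumes "crossing_order hs" "crossing_order hs'"
  shows "X \<in> L2_sep A (gallery_of hs) (gallery_of hs') \<longleftrightarrow> X \<in> L_codim A 2 \<and>
    (\<exists>G\<in>A. \<exists>H\<in>A. X \<subseteq> G \<and> X \<subseteq> H \<and> precedes hs G H \<and> precedes hs' H G)"
  by (simp add: L2_sep_def crosses_before_gallery_of assms)

lemma finite_L2_sep: "finite (L2_sep A r r')"
  using finite_L_codim[of 2] by (rule rev_finite_subset) (auto simp: L2_sep_def)

lemma L2_sep_self: "crossing_order hs \<Longrightarrow> L2_sep A (gallery_of hs) (gallery_of hs) = {}"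
proof -
  assume hs: "crossing_order hs"
  then show ?thesis
    using mem_L2_sep[OF hs hs] precedes_asym[OF crossing_orderD(1)[OF hs]] by auto
qed

text \<open>A pair inverted between the outer orders is inverted in one of the two stages, since the
  middle order ranks it too.\<close>

lemma L2_sep_triangle:
  assumes "crossing_order hs" "crossing_order hs'" "crossing_order hs''"
  shows "L2_sep A (gallery_of hs) (gallery_of hs'') \<subseteq>
    L2_sep A (gallery_of hs) (gallery_of hs') \<union> L2_sep A (gallery_of hs') (gallery_of hs'')"
proof
  fix X assume "X \<in> L2_sep A (gallery_of hs) (gallery_of hs'')"
  then obtain G H where GH: "X \<in> L_codim A 2" "G \<in> A" "H \<in> A" "X \<subseteq> G" "X \<subseteq> H"
      "precedes hs G H" "precedes hs'' H G"
    using mem_L2_sep assms by blast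
  have "G \<noteq> H" using GH(6) crossing_orderD(1)[OF assms(1)] precedes_irrefl by metis
  then have "precedes hs' G H \<or> precedes hs' H G"
    using precedes_total crossing_orderD(2)[OF assms(2)] GH by metis
  then show "X \<in> L2_sep A (gallery_of hs) (gallery_of hs') \<union> L2_sep A (gallery_of hs') (gallery_of hs'')"
    using GH mem_L2_sep assms by blast
qed

text \<open>Each step of the walk contributes one flat, and \<open>L2_sep_triangle\<close> adds
  these up. Through \<open>min_gallery_iff\<close>, \<open>hs0\<close> lets every vertex be written
  as a crossing order.\<close>

lemma card_L2_sep_le_walk:
  assumes hs0: "crossing_order hs0" and "G2_walk A (region {}) r r' ws"
  shows "card (L2_sep A r r') \<le> length ws - 1"
  using assms(2)
proof (induction ws arbitrary: r)
  case Nil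
  then show ?case by (simp add: G2_walk_def)
next
  case (Cons w ws)
  have co: "\<exists>hs. crossing_order hs \<and> v = gallery_of hs" if "v \<in> set (w # ws)" for v
    using Cons.prems that min_gallery_iff[OF hs0] by (auto simp: G2_walk_def)
  show ?case
  proof (cases ws)
    case Nil
    then have "r = w" "r' = w" using Cons.prems by (auto simp: G2_walk_def)
    then show ?thesis using co[of w] L2_sep_self by auto
  next
    case (Cons v vs)
    have r: "r = w" using Cons.prems by (simp add: G2_walk_def)
    have step: "card (L2_sep A w v) = 1"
      using Cons.prems Cons unfolding G2_walk_def by (auto dest!: spec[of _ 0])
    have "G2_walk A (region {}) v r' ws"
      using Cons.prems Cons unfolding G2_walk_def by (auto dest: spec[of _ "Suc _"])
    then have IH: "card (L2_sep A v r') \<le> length ws - 1" by (rule Cons.IH)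
    have "r' = last ws" using Cons.prems Cons by (simp add: G2_walk_def)
    then have "r' \<in> set ws" using Cons by simp
    then obtain a b c where "crossing_order a" "crossing_order b" "crossing_order c"
      "w = gallery_of a" "v = gallery_of b" "r' = gallery_of c"
      using co[of w] co[of v] co[of r'] Cons by auto
    then have "L2_sep A w r' \<subseteq> L2_sep A w v \<union> L2_sep A v r'" using L2_sep_triangle by blast
    then have "card (L2_sep A w r') \<le> card (L2_sep A w v \<union> L2_sep A v r')"
      using finite_L2_sep by (intro card_mono) auto
    also have "\<dots> \<le> card (L2_sep A w v) + card (L2_sep A v r')" by (rule card_Un_le)
    finally show ?thesis using step IH r Cons by simp
  qed
qed

end

section \<open>Arrangements graded by a modular flag\<close>

text \<open>
  For a modular flag \<open>F\<close>, \<open>lev H\<close> is the least \<open>i\<close> with \<open>F i\<close> not contained in \<open>H\<close>, and \<open>w i\<close>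
  is a point of \<open>F i\<close> and the closed base chamber lying on no hyperplane that does not contain \<open>F i\<close>.
\<close>

locale graded_arrangement = oriented_arrangement +
  fixes lev :: "'a set \<Rightarrow> nat" and w :: "nat \<Rightarrow> 'a"
  assumes lev_pos: "H \<in> A \<Longrightarrow> lev H > 0"
    and normal_w_zero: "H \<in> A \<Longrightarrow> i < lev H \<Longrightarrow> n H \<bullet> w i = 0"
    and normal_w_pos: "H \<in> A \<Longrightarrow> G \<in> A \<Longrightarrow> lev H \<le> i \<Longrightarrow> i \<le> lev G \<Longrightarrow> n H \<bullet> w i > 0"
    and modular: "G \<in> A \<Longrightarrow> H \<in> A \<Longrightarrow> G \<noteq> H \<Longrightarrow> lev G = lev H \<Longrightarrow>
      \<exists>K\<in>A. \<exists>t. lev G < lev K \<and> t \<noteq> 0 \<and>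
        (\<forall>x. n G \<bullet> x / (n G \<bullet> w (lev G)) - n H \<bullet> x / (n H \<bullet> w (lev H)) = t * (n K \<bullet> x))"
begin

text \<open>A displacement by \<open>s *\<^sub>R w i\<close> adds \<open>s\<close> to the heights of
  all members of \<open>A\<close> of level \<open>i\<close>, so it does not affect their
  comparison.\<close>

definition height :: "'a set \<Rightarrow> 'a \<Rightarrow> real" where
  "height H x = n H \<bullet> x / (n H \<bullet> w (lev H))"

definition graded_order :: "'a set list \<Rightarrow> bool" where
  "graded_order hs \<longleftrightarrow> (\<forall>G\<in>A. \<forall>H\<in>A. lev H < lev G \<longrightarrow> precedes hs G H)"

lemma normal_w_lev_pos: "H \<in> A \<Longrightarrow> n H \<bullet> w (lev H) > 0"
  using normal_w_pos by blast

lemma height_sign: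
  assumes "H \<in> A"
  shows "height H x < 0 \<longleftrightarrow> n H \<bullet> x < 0" "height H x > 0 \<longleftrightarrow> n H \<bullet> x > 0"
    "height H x = 0 \<longleftrightarrow> n H \<bullet> x = 0"
  using normal_w_lev_pos[OF assms]
  by (auto simp: height_def divide_less_0_iff zero_less_divide_iff)

lemma height_diff:
  assumes "G \<in> A" "H \<in> A" "G \<noteq> H" "lev G = lev H"
  obtains K t where "K \<in> A" "lev G < lev K" "t \<noteq> 0"
    "\<And>x. height G x - height H x = t * (n K \<bullet> x)"
  using modular[OF assms] unfolding height_def by blast

text \<open>If the orders disagreed, the chambers just before \<open>H\<close> in \<open>hs\<close>
  and just before \<open>G\<close> in \<open>hs'\<close> would contain points with opposite signs of
  the height difference, yet both negative on \<open>K\<close>.\<close>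

lemma same_order_after_join:
  assumes hs: "crossing_order hs" "crossing_order hs'"
    and GH: "G \<in> A" "H \<in> A" "precedes hs G H"
    and eq: "\<And>x. height G x - height H x = t * (n K \<bullet> x)"
    and K: "precedes hs K H" "precedes hs' K G"
  shows "precedes hs' G H"
proof (rule ccontr)
  assume "\<not> precedes hs' G H"
  moreover have "G \<noteq> H" using GH(3) crossing_orderD(1)[OF hs(1)] precedes_irrefl by metis
  ultimately have HG: "precedes hs' H G"
    using precedes_total GH crossing_orderD(2)[OF hs(2)] by metis
  obtain x where x: "n G \<bullet> x < 0" "n H \<bullet> x > 0" "n K \<bullet> x < 0"
    using separating_point[OF hs(1) GH(3)] K(1) by metis
  obtain y where y: "n H \<bullet> y < 0" "n G \<bullet> y > 0" "n K \<bullet> y < 0"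
    using separating_point[OF hs(2) HG] K(2) by metis
  have "t * (n K \<bullet> x) < 0" using eq[of x] x height_sign GH(1,2) by smt
  moreover have "t * (n K \<bullet> y) > 0" using eq[of y] y height_sign GH(1,2) by smt
  ultimately show False using x y by (auto simp: mult_less_0_iff zero_less_mult_iff)
qed

text \<open>Between levels the order is prescribed. Within a level, the \<open>K\<close> of
  \<open>height_diff\<close> has higher level, so it precedes both hyperplanes in both orders and
  fixes theirs.\<close>

lemma graded_order_unique:
  assumes hs: "crossing_order hs" "graded_order hs" and hs': "crossing_order hs'" "graded_order hs'"
  shows "hs = hs'"
proof (rule list_eq_if_precedes_eq)
  show "precedes hs' G H" if GH: "precedes hs G H" for G H
  proof -
    have A: "G \<in> A" "H \<in> A" using precedes_in_set[OF GH] crossing_orderD(2)[OF hs(1)] by auto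
    have ne: "G \<noteq> H" using GH crossing_orderD(1)[OF hs(1)] precedes_irrefl by metis
    consider "lev H < lev G" | "lev G < lev H" | "lev G = lev H" by linarith
    then show ?thesis
    proof cases
      case 1
      then show ?thesis using hs'(2) A by (auto simp: graded_order_def)
    next
      case 2
      then have "precedes hs H G" using hs(2) A by (auto simp: graded_order_def)
      then show ?thesis using GH precedes_asym crossing_orderD(1)[OF hs(1)] by metis
    next
      case 3
      obtain K t where K: "K \<in> A" "lev G < lev K" "\<And>x. height G x - height H x = t * (n K \<bullet> x)"
        using height_diff[OF A ne 3] by metis
      show ?thesis
        by (rule same_order_after_join[OF hs(1) hs'(1) A GH K(3)])
          (use K 3 A hs(2) hs'(2) in \<open>auto simp: graded_order_def\<close>)
    qed
  qed
qed (use hs(1) hs'(1) crossing_orderD in auto)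

lemma ex_graded_order: "\<exists>hs. crossing_order hs \<and> graded_order hs"
proof -
  obtain x0 where x0: "\<And>H. H \<in> A \<Longrightarrow> n H \<bullet> x0 > 0" using base_point by blast
  \<comment> \<open>On \<open>- x0 + s *\<^sub>R w i\<close> a hyperplane of level \<open>i\<close>
    is negative exactly when its height at \<open>x0\<close> exceeds \<open>s\<close>. Lowering
    \<open>s\<close> thus crosses larger heights first.\<close>
  define r where "r G H \<longleftrightarrow> lev H < lev G \<or> lev H = lev G \<and> height H x0 < height G x0" for G H
  have ne: "height G x0 \<noteq> height H x0" if GH: "G \<in> A" "H \<in> A" "G \<noteq> H" "lev G = lev H" for G H
  proof -
    obtain K t where K: "K \<in> A" "t \<noteq> 0" "\<And>x. height G x - height H x = t * (n K \<bullet> x)"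
      using height_diff[OF GH] by metis
    have "t * (n K \<bullet> x0) \<noteq> 0" using x0[OF K(1)] K(2) by simp
    then show ?thesis using K(3)[of x0] by linarith
  qed
  have "\<exists>hs. distinct hs \<and> set hs = A \<and> (\<forall>G H. precedes hs G H \<longrightarrow> r G H)"
  proof (rule ex_distinct_list_precedes[OF finite_A])
    show "r G H \<or> r H G" if "G \<in> A" "H \<in> A" "G \<noteq> H" for G H
      using ne[OF that] unfolding r_def by linarith
    show "r G K" if "r G H" "r H K" for G H K
      using that unfolding r_def by linarith
  qed
  then obtain hs where hs: "distinct hs" "set hs = A" "\<And>G H. precedes hs G H \<Longrightarrow> r G H" by metis
  have "region (set P) \<noteq> {}" if eq: "hs = P @ R" for P R
  proof (cases R)
    case Nil
    then have "- x0 \<in> region (set P)" using eq hs(2) x0 by (auto simp: region_def)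
    then show ?thesis by blast
  next
    case (Cons G R')
    define i where "i = lev G"
    have G: "G \<in> A" using eq Cons hs(2) by auto
    have before: "r H G" if "H \<in> set P" for H
      using hs(3)[of H G] that eq Cons by (auto simp: precedes_append)
    have after: "r G H" if "H \<in> set R'" for H
      using hs(3)[of G H] that eq Cons by (auto simp: precedes_append)
    \<comment> \<open>\<open>u\<close> lies on \<open>G\<close>, the next hyperplane to be crossed,
      and has the required signs on higher levels and on the rest of level \<open>i\<close>;
      \<open>q\<close> moves \<open>G\<close> to its positive side.\<close>
    define u where "u = - x0 + height G x0 *\<^sub>R w i"
    obtain q where q: "\<forall>H\<in>A. sgn (n H \<bullet> q) =
        (if n H \<bullet> u \<noteq> 0 then sgn (n H \<bullet> u) else sgn (n H \<bullet> w i))"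
      using perturbed_signs[OF finite_A] by blast
    \<comment> \<open>\<open>w (i - 1)\<close> is positive on all levels below \<open>i\<close> and
      vanishes on the others. Letting it dominate makes the lower levels positive and keeps the
      signs of \<open>q\<close> elsewhere.\<close>
    obtain p where p: "\<forall>H\<in>A. sgn (n H \<bullet> p) = (if n H \<bullet> w (i - 1) \<noteq> 0
        then sgn (n H \<bullet> w (i - 1)) else sgn (n H \<bullet> q))"
      using perturbed_signs[OF finite_A] by blast
    have "if H \<in> set P then n H \<bullet> p < 0 else n H \<bullet> p > 0" if H: "H \<in> A" for H
    proof -
      consider (low) "lev H < i" | (high) "i < lev H" | (same) "lev H = i" by linarith
      then show ?thesis
      proof cases
        case low
        then have "n H \<bullet> w (i - 1) > 0" using normal_w_pos[OF H G, of "i - 1"] by (simp add: i_def)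
        moreover have "H \<notin> set P" using before[of H] low by (auto simp: r_def i_def)
        ultimately show ?thesis using p H by (auto simp: sgn_if split: if_splits)
      next
        case high
        then have "n H \<bullet> w (i - 1) = 0" "n H \<bullet> w i = 0" using normal_w_zero[OF H] by auto
        moreover from this have "n H \<bullet> q < 0"
          using q[rule_format, OF H] x0[OF H] by (auto simp: u_def inner_diff_right sgn_if split: if_splits)
        moreover have "H \<in> set P"
          using H hs(2) eq Cons after[of H] high by (auto simp: r_def i_def)
        ultimately show ?thesis using p H by (auto simp: sgn_if split: if_splits)
      next
        case same
        have wi: "n H \<bullet> w i > 0" using normal_w_lev_pos[OF H] same by simp
        have "n H \<bullet> w (i - 1) = 0" using normal_w_zero[OF H, of "i - 1"] lev_pos[OF H] same by simp
        then have sp: "sgn (n H \<bullet> p) = sgn (n H \<bullet> q)" using p H by simp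
        have "n H \<bullet> x0 = height H x0 * (n H \<bullet> w i)" using wi same by (simp add: height_def)
        then have v: "n H \<bullet> u = (height G x0 - height H x0) * (n H \<bullet> w i)"
          by (simp add: u_def inner_diff_right algebra_simps)
        consider "H \<in> set P" | "H = G" | "H \<in> set R'" using H hs(2) eq Cons by auto
        then show ?thesis
        proof cases
          case 1
          have "n H \<bullet> u < 0"
            using before[OF 1] same wi unfolding v by (auto simp: r_def i_def mult_less_0_iff)
          then have "sgn (n H \<bullet> q) = -1" using q[rule_format, OF H] by simp
          then show ?thesis using sp 1 by (auto simp: sgn_if split: if_splits)
        next
          case 2
          then have "sgn (n H \<bullet> q) = 1" using q[rule_format, OF H] wi unfolding v by simp
          moreover have "H \<notin> set P" using 2 hs(1) eq Cons by auto
          ultimately show ?thesis using sp by (auto simp: sgn_if split: if_splits)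
        next
          case 3
          have "n H \<bullet> u > 0"
            using after[OF 3] same wi unfolding v by (auto simp: r_def i_def zero_less_mult_iff)
          then have "sgn (n H \<bullet> q) = 1" using q[rule_format, OF H] by simp
          moreover have "H \<notin> set P" using 3 hs(1) eq Cons by auto
          ultimately show ?thesis using sp by (auto simp: sgn_if split: if_splits)
        qed
      qed
    qed
    then have "p \<in> region (set P)" by (simp add: region_def)
    then show ?thesis by blast
  qed
  then have "crossing_order hs" using hs(1,2) by (auto simp: crossing_order_def)
  moreover have "graded_order hs"
    unfolding graded_order_def
  proof (intro ballI impI)
    fix G H assume GH: "G \<in> A" "H \<in> A" "lev H < lev G"
    then have "\<not> precedes hs H G" using hs(3)[of H G] by (auto simp: r_def)
    then show "precedes hs G H" using precedes_total[of G hs H] GH hs(2) by auto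
  qed
  ultimately show ?thesis by blast
qed

section \<open>Reversing a block to approach the graded order\<close>

lemma ungraded_block:
  assumes hs: "crossing_order hs" and ungraded: "\<not> graded_order hs"
  obtains P Q K R i z where "hs = P @ (Q @ [K]) @ R" "Q \<noteq> []" "i < lev K"
    "\<forall>G\<in>set Q. lev G = i" "\<forall>G\<in>set P. n G \<bullet> z < 0"
    "\<forall>G\<in>set (Q @ [K]). n G \<bullet> z = 0" "\<forall>G\<in>set R. n G \<bullet> z > 0"
proof -
  have d: "distinct hs" "set hs = A" using crossing_orderD[OF hs] by auto
  define bad where "bad i \<longleftrightarrow> (\<exists>H K. lev H = i \<and> i < lev K \<and> precedes hs H K)" for i
  have "\<exists>i. bad i"
  proof -
    obtain G H where GH: "G \<in> A" "H \<in> A" "lev H < lev G" "\<not> precedes hs G H"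
      using ungraded by (auto simp: graded_order_def)
    then have "precedes hs H G" using precedes_total[of G hs H] d(2) by auto
    then show ?thesis using GH(3) unfolding bad_def by blast
  qed
  then obtain i where "bad i" and least: "\<And>j. bad j \<Longrightarrow> i \<le> j"
    using LeastI_ex Least_le by metis
  then obtain H0 K0 where HK0: "lev H0 = i" "i < lev K0" "precedes hs H0 K0"
    unfolding bad_def by blast
  \<comment> \<open>\<open>P0\<close> is the longest initial run above level \<open>i\<close> and
    \<open>Q0\<close> the run of levels at most \<open>i\<close> after it; the first return to a
    higher level will be \<open>K\<close>.\<close>
  define P0 where "P0 = takeWhile (\<lambda>H. i < lev H) hs"
  define T where "T = dropWhile (\<lambda>H. i < lev H) hs"
  define Q0 where "Q0 = takeWhile (\<lambda>H. lev H \<le> i) T"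
  define U where "U = dropWhile (\<lambda>H. lev H \<le> i) T"
  have hsT: "hs = P0 @ T" and TU: "T = Q0 @ U"
    by (simp_all add: P0_def T_def Q0_def U_def)
  have P0: "i < lev G" if "G \<in> set P0" for G using that set_takeWhileD unfolding P0_def by metis
  have "H0 \<notin> set P0" using P0 HK0(1) by blast
  then have HKT: "precedes T H0 K0"
    using HK0(3) hsT by (auto simp: precedes_append dest: precedes_in_set)
  then have "T \<noteq> []" by auto
  then have "\<not> i < lev (hd T)" unfolding T_def by (rule hd_dropWhile)
  then have Q0ne: "Q0 \<noteq> []" using \<open>T \<noteq> []\<close> unfolding Q0_def by (cases T) auto
  have "U \<noteq> []"
    using precedes_in_set[OF HKT] HK0(2) unfolding U_def by (metis dropWhile_eq_Nil_conv not_le)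
  then obtain K R where U: "U = K # R" by (cases U) auto
  have K: "i < lev K" using hd_dropWhile[of "\<lambda>H. lev H \<le> i" T] U unfolding U_def by auto
  have hs_eq: "hs = P0 @ Q0 @ K # R" using hsT TU U by simp
  have A: "set P0 \<subseteq> A" "set Q0 \<subseteq> A" "K \<in> A" "set R \<subseteq> A" "A = set P0 \<union> set Q0 \<union> {K} \<union> set R"
    using d(2) hs_eq by auto
  \<comment> \<open>Each member of \<open>Q0\<close> precedes \<open>K\<close>, so a level below
    \<open>i\<close> would contradict the choice of \<open>i\<close>.\<close>
  have Q0: "lev G = i" if "G \<in> set Q0" for G
  proof -
    have le: "lev G \<le> i" using that set_takeWhileD unfolding Q0_def by metis
    have "precedes hs G K" using that hs_eq by (auto simp: precedes_append)
    then have "bad (lev G)" using le K unfolding bad_def by (metis le_less_trans)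
    then show ?thesis using least le by (meson le_antisym)
  qed

  obtain x1 where x1: "x1 \<in> region (set (P0 @ Q0))"
    using crossing_orderD(3)[OF hs, of "P0 @ Q0" "K # R"] hs_eq by auto
  obtain x2 where x2: "x2 \<in> region (set (P0 @ Q0 @ [K]))"
    using crossing_orderD(3)[OF hs, of "P0 @ Q0 @ [K]" R] hs_eq by auto
  have dis: "distinct (P0 @ Q0 @ K # R)" using d(1) hs_eq by simp
  \<comment> \<open>\<open>x1\<close> and \<open>x2\<close> lie in the chambers on the two sides of
    the wall \<open>K\<close>. \<open>y\<close> is the positive combination at which
    \<open>K\<close> vanishes; it keeps their common signs on all other hyperplanes.\<close>
  define y where "y = (n K \<bullet> x1) *\<^sub>R x2 - (n K \<bullet> x2) *\<^sub>R x1"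
  have K12: "n K \<bullet> x1 > 0" "n K \<bullet> x2 < 0"
    using regionD(2)[OF x1 A(3)] regionD(1)[OF x2 A(3)] dis by auto
  have ny: "n G \<bullet> y = (n K \<bullet> x1) * (n G \<bullet> x2) + (- (n K \<bullet> x2)) * (n G \<bullet> x1)" for G
    by (simp add: y_def inner_diff_right)
  have yK: "n K \<bullet> y = 0" by (simp add: ny)
  have yneg: "n G \<bullet> y < 0" if "G \<in> set P0 \<union> set Q0" for G
  proof -
    have "n G \<bullet> x1 < 0" "n G \<bullet> x2 < 0"
      using regionD(1)[OF x1, of G] regionD(1)[OF x2, of G] that A by auto
    then show ?thesis unfolding ny using K12
      by (intro add_neg_neg mult_pos_neg) auto
  qed
  have ypos: "n G \<bullet> y > 0" if "G \<in> set R" for G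
  proof -
    have "G \<in> A" "G \<notin> set (P0 @ Q0 @ [K])" using that A dis by auto
    then have "n G \<bullet> x1 > 0" "n G \<bullet> x2 > 0"
      using regionD(2)[OF x1, of G] regionD(2)[OF x2, of G] by auto
    then show ?thesis unfolding ny using K12
      by (intro add_pos_pos mult_pos_pos) auto
  qed
  \<comment> \<open>No hyperplane of level above \<open>i\<close> is crossed inside \<open>Q0\<close>, so the sign of the join of two
    members of \<open>Q0\<close> is still the same at the wall point \<open>y\<close>, unless the join is \<open>K\<close>.\<close>
  have mono: "height G y \<le> height H y" if GH: "precedes Q0 G H" for G H
  proof -
    have in_Q: "G \<in> set Q0" "H \<in> set Q0" using precedes_in_set[OF GH] by auto
    then have GHA: "G \<in> A" "H \<in> A" "lev H = lev G" using A Q0 by auto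
    have "G \<noteq> H" using GH dis precedes_irrefl[of Q0] by auto
    then obtain M t where M: "M \<in> A" "lev H < lev M" "\<And>x. height H x - height G x = t * (n M \<bullet> x)"
      using height_diff[OF GHA(2,1) _ GHA(3)] by metis
    obtain S1 S2 where S: "Q0 = S1 @ H # S2" "G \<in> set S1" using precedes_split[OF GH] by metis
    then obtain x where x: "x \<in> region (set (P0 @ S1))"
      using crossing_orderD(3)[OF hs, of "P0 @ S1" "H # S2 @ K # R"] hs_eq by auto
    have "n G \<bullet> x < 0" using regionD(1)[OF x GHA(1)] S by auto
    moreover have "n H \<bullet> x > 0" using regionD(2)[OF x GHA(2)] S dis by auto
    ultimately have t: "t * (n M \<bullet> x) > 0"
      using M(3)[of x] height_sign[OF GHA(1)] height_sign[OF GHA(2)] by smt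
    have Mi: "i < lev M" using M(2) Q0 in_Q by simp
    then have MQ: "M \<notin> set Q0" using Q0 by blast
    then consider "M \<in> set P0" | "M = K" | "M \<in> set R" using M(1) A by blast
    then have "t * (n M \<bullet> y) \<ge> 0"
    proof cases
      case 1
      then have "n M \<bullet> x < 0" "n M \<bullet> y < 0" using regionD(1)[OF x M(1)] yneg by auto
      then show ?thesis using t by (auto simp: zero_less_mult_iff zero_le_mult_iff)
    next
      case 2
      then show ?thesis using yK by simp
    next
      case 3
      then have "M \<notin> set (P0 @ S1)" using MQ S dis by auto
      then have "n M \<bullet> x > 0" "n M \<bullet> y > 0" using regionD(2)[OF x M(1)] ypos 3 by auto
      then show ?thesis using t by (auto simp: zero_less_mult_iff zero_le_mult_iff)
    qed
    then show ?thesis using M(3)[of y] by linarith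
  qed

  define L where "L = last Q0"
  have L: "L \<in> set Q0" "L \<in> A" using Q0ne A by (auto simp: L_def)
  \<comment> \<open>Moving along \<open>w i\<close> leaves levels above \<open>i\<close> fixed and
    raises all heights on \<open>Q0\<close> equally. \<open>L\<close> has the largest of these,
    negative at \<open>y\<close>; stopping when it reaches zero makes none of them positive.\<close>
  define z where "z = y - height L y *\<^sub>R w i"
  have Ly: "height L y < 0" using height_sign(1)[OF L(2)] yneg L(1) by auto
  have nz: "n G \<bullet> z = n G \<bullet> y + (- height L y) * (n G \<bullet> w i)" for G
    by (simp add: z_def inner_diff_right)
  have high: "n G \<bullet> z = n G \<bullet> y" if "G \<in> A" "i < lev G" for G
    using normal_w_zero[OF that] nz by simp
  have heightz: "height G z = height G y - height L y" if "G \<in> set Q0" for G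
  proof -
    have "n G \<bullet> w i > 0" using normal_w_lev_pos[of G] Q0[OF that] that A by auto
    then show ?thesis using Q0[OF that] by (simp add: height_def nz field_simps)
  qed
  have le_L: "height G y \<le> height L y" if "G \<in> set Q0" for G
  proof (cases "G = L")
    case False
    then have "G \<in> set (butlast Q0)"
      using that Q0ne unfolding L_def
      by (metis append_butlast_last_id in_set_butlastD rotate1.simps(2) set_ConsD set_rotate1)
    moreover have "Q0 = butlast Q0 @ [L]" using Q0ne by (simp add: L_def)
    ultimately have "precedes Q0 G L" by (metis list.set_intros(1) precedes_append)
    then show ?thesis by (rule mono)
  qed simp
  \<comment> \<open>The members still negative at \<open>z\<close> go into the first part of the
    decomposition. From the first non-negative one on, monotonicity and the maximality of
    \<open>L\<close> squeeze all heights to zero.\<close>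
  define Q1 where "Q1 = takeWhile (\<lambda>G. n G \<bullet> z < 0) Q0"
  define Q where "Q = dropWhile (\<lambda>G. n G \<bullet> z < 0) Q0"
  have Q0_eq: "Q0 = Q1 @ Q" by (simp add: Q1_def Q_def)
  have Lz: "n L \<bullet> z = 0" using heightz[OF L(1)] height_sign(3)[OF L(2)] by simp
  have Qne: "Q \<noteq> []" using L(1) Lz unfolding Q_def by (metis dropWhile_eq_Nil_conv less_irrefl)
  have Qz: "n G \<bullet> z = 0" if G: "G \<in> set Q" for G
  proof -
    have hdQ: "hd Q \<in> set Q0" "\<not> n (hd Q) \<bullet> z < 0"
      using Qne Q0_eq hd_dropWhile[of "\<lambda>G. n G \<bullet> z < 0" Q0] unfolding Q_def[symmetric] by auto
    then have "height (hd Q) z \<ge> 0" using height_sign(1)[of "hd Q" z] A by auto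
    moreover have "height (hd Q) y \<le> height G y"
    proof (cases "G = hd Q")
      case False
      obtain q Q' where "Q = q # Q'" using Qne by (cases Q) auto
      then have "precedes Q (hd Q) G" using False G by auto
      then show ?thesis using mono Q0_eq by (simp add: precedes_append)
    qed simp
    moreover have "G \<in> set Q0" using G Q0_eq by simp
    ultimately have "height G z = 0" using heightz[OF hdQ(1)] heightz[of G] le_L[of G] by linarith
    then show ?thesis using height_sign(3)[of G z] \<open>G \<in> set Q0\<close> A by auto
  qed
  show ?thesis
  proof (rule that[of "P0 @ Q1" Q K R i z])
    show "hs = (P0 @ Q1) @ (Q @ [K]) @ R" using hs_eq Q0_eq by simp
    have "n G \<bullet> z < 0" if "G \<in> set (P0 @ Q1)" for G
    proof (cases "G \<in> set P0")
      case True
      then show ?thesis using high[of G] P0 yneg A by auto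
    next
      case False
      then show ?thesis using that set_takeWhileD unfolding Q1_def by fastforce
    qed
    then show "\<forall>G\<in>set (P0 @ Q1). n G \<bullet> z < 0" by blast
    have "n G \<bullet> z = 0" if "G \<in> set (Q @ [K])" for G
      using that Qz high[OF A(3) K] yK by auto
    then show "\<forall>G\<in>set (Q @ [K]). n G \<bullet> z = 0" by blast
    \<comment> \<open>On levels at most \<open>i\<close> the displacement raises the value, since
      \<open>height L y\<close> is negative; on higher levels nothing changes.\<close>
    have "n G \<bullet> z > 0" if "G \<in> set R" for G
    proof (cases "i < lev G")
      case True
      then show ?thesis using high[of G] ypos[OF that] that A by auto
    next
      case False
      then have "n G \<bullet> w i > 0" using normal_w_pos[of G L i] that A Q0[OF L(1)] L(2) by auto
      then have "(- height L y) * (n G \<bullet> w i) > 0" using Ly by (intro mult_pos_pos) auto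
      then show ?thesis using ypos[OF that] nz by simp
    qed
    then show "\<forall>G\<in>set R. n G \<bullet> z > 0" by blast
  qed (use Qne K Q0 Q0_eq in auto)
qed

text \<open>Reversing \<open>Q @ [K]\<close> puts \<open>K\<close> before \<open>Q\<close>, as in
  \<open>hs0\<close>, and this forces the order inside \<open>Q\<close> to agree with
  \<open>hs0\<close> as well. A flat other than \<open>X\<close> lies in at most one hyperplane of
  the block, so its crossing order is untouched.\<close>

lemma descent:
  assumes hs0: "crossing_order hs0" "graded_order hs0"
    and hs: "crossing_order hs" "\<not> graded_order hs"
  obtains hs' X where "crossing_order hs'"
    "L2_sep A (gallery_of hs') (gallery_of hs) = {X}"
    "X \<in> L2_sep A (gallery_of hs0) (gallery_of hs)"
    "L2_sep A (gallery_of hs0) (gallery_of hs') = L2_sep A (gallery_of hs0) (gallery_of hs) - {X}"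
proof -
  obtain P Q K R i z where hs_eq: "hs = P @ (Q @ [K]) @ R" and Qne: "Q \<noteq> []" and K: "i < lev K"
    and Q': "\<forall>G\<in>set Q. lev G = i"
    and z': "\<forall>G\<in>set P. n G \<bullet> z < 0" "\<forall>G\<in>set (Q @ [K]). n G \<bullet> z = 0"
      "\<forall>G\<in>set R. n G \<bullet> z > 0"
    by (rule ungraded_block[OF hs]) (rule that)
  note Q = Q'[rule_format] and z = z'[rule_format]
  define B where "B = Q @ [K]"
  have hsB: "hs = P @ B @ R" using hs_eq by (simp add: B_def)
  have zB: "\<And>G. G \<in> set B \<Longrightarrow> n G \<bullet> z = 0" using z(2) by (simp add: B_def)
  define hs' where "hs' = P @ rev B @ R"
  have hs': "crossing_order hs'"
    unfolding hs'_def using crossing_order_flip[of P B R z] hs(1) z(1,3) zB hsB by blast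
  have d: "distinct hs" "set hs = A" using crossing_orderD[OF hs(1)] by auto
  have KA: "K \<in> A" and QA: "set Q \<subseteq> A" using d(2) hsB B_def by auto
  have flip: "precedes hs' G H \<longleftrightarrow>
      (if G \<in> set B \<and> H \<in> set B then precedes hs H G else precedes hs G H)" for G H
    using precedes_rev_block[of P B R] d(1) hsB unfolding hs'_def by simp
  obtain L where L: "L \<in> set Q" "L \<in> A" using Qne QA by (cases Q) auto
  have LK: "L \<noteq> K" using Q[OF L(1)] K by auto
  define X where "X = L \<inter> K"
  have X2: "X \<in> L_codim A 2" unfolding X_def using Int_in_L_codim[OF L(2) KA LK] .
  have zX: "z \<in> X" unfolding X_def using zB[of L] zB[of K] L(1) mem_hyperplane_iff KA L(2)
    by (simp add: B_def)
  \<comment> \<open>Both heights vanish at \<open>z\<close>, so \<open>M\<close> passes through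
    \<open>z\<close> and belongs to \<open>B\<close>; its level exceeds \<open>i\<close>, which
    leaves only \<open>K\<close>.\<close>
  have join_K: "\<exists>t. \<forall>x. height G x - height H x = t * (n K \<bullet> x)"
    if GH: "G \<in> set Q" "H \<in> set Q" "G \<noteq> H" for G H
  proof -
    have "G \<in> A" "H \<in> A" "lev G = lev H" using GH Q QA by auto
    then obtain M t where M: "M \<in> A" "lev G < lev M" "\<And>x. height G x - height H x = t * (n M \<bullet> x)"
      "t \<noteq> 0"
      using height_diff[of G H] GH(3) by metis
    have "height G z = 0" "height H z = 0" using zB GH by (auto simp: height_def B_def)
    then have "n M \<bullet> z = 0" using M(3)[of z] M(4) by simp
    then have "M \<in> set B" using M(1) d(2) hsB z(1)[of M] z(3)[of M] by fastforce
    then have "M = K" using Q[OF GH(1)] Q[of M] M(2) by (auto simp: B_def)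
    then show ?thesis using M(3) by blast
  qed
  \<comment> \<open>\<open>z\<close> lies in \<open>X\<close> and only on hyperplanes of
    \<open>B\<close>. Conversely, heights on \<open>Q\<close> differ from that of \<open>L\<close>
    by multiples of the form of \<open>K\<close>, so they vanish on \<open>X\<close>.\<close>
  have XB: "X \<subseteq> G \<longleftrightarrow> G \<in> set B" if G: "G \<in> A" for G
  proof
    assume "X \<subseteq> G"
    then have "n G \<bullet> z = 0" using zX mem_hyperplane_iff[OF G] by blast
    then show "G \<in> set B" using G d(2) hsB z(1)[of G] z(3)[of G] by fastforce
  next
    assume GB: "G \<in> set B"
    show "X \<subseteq> G"
    proof (cases "G = K \<or> G = L")
      case False
      then have GQ: "G \<in> set Q" "G \<noteq> L" using GB by (auto simp: B_def)
      then obtain t where t: "\<And>x. height G x - height L x = t * (n K \<bullet> x)"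
        using join_K L(1) by metis
      show ?thesis
      proof
        fix x assume "x \<in> X"
        then have "n K \<bullet> x = 0" "height L x = 0"
          using mem_hyperplane_iff[OF KA] mem_hyperplane_iff[OF L(2)] by (auto simp: X_def height_def)
        then have "height G x = 0" using t[of x] by simp
        then show "x \<in> G" using height_sign(3)[OF G] mem_hyperplane_iff[OF G] by blast
      qed
    qed (auto simp: X_def)
  qed
  have KQ': "precedes hs' K G" if "G \<in> set Q" for G
    using that unfolding hs'_def B_def by (auto simp: precedes_append)
  have KQ: "precedes hs G K" if "G \<in> set Q" for G
    using that unfolding hs_eq by (auto simp: precedes_append)
  have KQ0: "precedes hs0 K G" if "G \<in> set Q" for G
    using that hs0(2) Q K QA KA unfolding graded_order_def by auto
  have other: "\<not> (G \<in> set B \<and> H \<in> set B)"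
    if "Y \<in> L_codim A 2" "Y \<noteq> X" "G \<in> A" "H \<in> A" "Y \<subseteq> G" "Y \<subseteq> H" "G \<noteq> H" for Y G H
  proof
    assume "G \<in> set B \<and> H \<in> set B"
    then have "X = G \<inter> H" using L_codim_2_eq_Int[OF X2] that XB by blast
    moreover have "Y = G \<inter> H" using L_codim_2_eq_Int that by blast
    ultimately show False using that(2) by simp
  qed
  have irr: "G \<noteq> H" if "precedes hs'' G H" "crossing_order hs''" for G H hs''
    using that crossing_orderD(1) precedes_irrefl by metis
  have asym: "\<not> precedes hs'' H G" if "precedes hs'' G H" "crossing_order hs''" for G H hs''
    using that crossing_orderD(1) precedes_asym by metis
  have one: "L2_sep A (gallery_of hs') (gallery_of hs) = {X}"
  proof (intro equalityI subsetI)
    fix Y assume "Y \<in> L2_sep A (gallery_of hs') (gallery_of hs)"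
    then obtain G H where GH: "Y \<in> L_codim A 2" "G \<in> A" "H \<in> A" "Y \<subseteq> G" "Y \<subseteq> H"
        "precedes hs' G H" "precedes hs H G"
      unfolding mem_L2_sep[OF hs' hs(1)] by blast
    have "G \<in> set B \<and> H \<in> set B"
      using flip[of G H] GH(6,7) asym[OF GH(7) hs(1)] by (auto split: if_splits)
    then show "Y \<in> {X}" using other[OF GH(1) _ GH(2-5)] irr[OF GH(6) hs'] by blast
  next
    fix Y assume "Y \<in> {X}"
    moreover have "X \<subseteq> L" "X \<subseteq> K" by (auto simp: X_def)
    ultimately show "Y \<in> L2_sep A (gallery_of hs') (gallery_of hs)"
      unfolding mem_L2_sep[OF hs' hs(1)] using X2 KQ[OF L(1)] KQ'[OF L(1)] KA L(2) by blast
  qed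
  have X_in: "X \<in> L2_sep A (gallery_of hs0) (gallery_of hs)"
  proof -
    have "X \<subseteq> L" "X \<subseteq> K" by (auto simp: X_def)
    then show ?thesis
      unfolding mem_L2_sep[OF hs0(1) hs(1)] using X2 KQ[OF L(1)] KQ0[OF L(1)] KA L(2) by blast
  qed
  have X_notin: "X \<notin> L2_sep A (gallery_of hs0) (gallery_of hs')"
  proof
    assume "X \<in> L2_sep A (gallery_of hs0) (gallery_of hs')"
    then obtain G H where GH: "G \<in> A" "H \<in> A" "X \<subseteq> G" "X \<subseteq> H"
        "precedes hs0 G H" "precedes hs' H G"
      unfolding mem_L2_sep[OF hs0(1) hs'] by blast
    have ne: "G \<noteq> H" using irr[OF GH(5) hs0(1)] .
    have GHB: "G \<in> set B" "H \<in> set B" using XB GH by auto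
    consider "G = K" "H \<in> set Q" | "H = K" "G \<in> set Q" | "G \<in> set Q" "H \<in> set Q"
      using GHB ne by (auto simp: B_def)
    then show False
    proof cases
      case 1
      then show ?thesis using KQ' GH(6) asym hs' by blast
    next
      case 2
      then show ?thesis using KQ0 GH(5) asym hs0(1) by blast
    next
      case 3
      \<comment> \<open>\<open>K\<close> precedes all of \<open>Q\<close> in both \<open>hs0\<close>
        and \<open>hs'\<close>, so \<open>same_order_after_join\<close> applies.\<close>
      obtain t where "\<And>x. height G x - height H x = t * (n K \<bullet> x)" using join_K[OF 3 ne] by blast
      then have "precedes hs' G H"
        using same_order_after_join[OF hs0(1) hs' GH(1,2,5)] KQ0[OF 3(2)] KQ'[OF 3(1)] by blast
      then show ?thesis using GH(6) asym hs' by blast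
    qed
  qed
  have "Y \<in> L2_sep A (gallery_of hs0) (gallery_of hs') \<longleftrightarrow>
      Y \<in> L2_sep A (gallery_of hs0) (gallery_of hs)" if Y: "Y \<noteq> X" for Y
  proof -
    have "precedes hs' H G \<longleftrightarrow> precedes hs H G"
      if "Y \<in> L_codim A 2" "G \<in> A" "H \<in> A" "Y \<subseteq> G" "Y \<subseteq> H" "precedes hs0 G H" for G H
      using other[OF that(1) Y that(2-5) irr[OF that(6) hs0(1)]] flip[of H G] by auto
    then show ?thesis unfolding mem_L2_sep[OF hs0(1) hs'] mem_L2_sep[OF hs0(1) hs(1)] by blast
  qed
  then have "Y \<in> L2_sep A (gallery_of hs0) (gallery_of hs') \<longleftrightarrow>
      Y \<in> L2_sep A (gallery_of hs0) (gallery_of hs) - {X}" for Y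
    using X_notin by (cases "Y = X") simp_all
  then have "L2_sep A (gallery_of hs0) (gallery_of hs') = L2_sep A (gallery_of hs0) (gallery_of hs) - {X}"
    by (rule set_eqI)
  then show ?thesis by (rule that[OF hs' one X_in])
qed

text \<open>Each \<open>descent\<close> removes one flat, and the gallery of \<open>hs\<close> is
  appended to the walk for \<open>hs'\<close>. The recursion ends at a graded order, which is
  \<open>hs0\<close> by uniqueness.\<close>

lemma ex_walk:
  assumes hs0: "crossing_order hs0" "graded_order hs0" and "crossing_order hs"
  shows "\<exists>ws. G2_walk A (region {}) (gallery_of hs0) (gallery_of hs) ws \<and>
    length ws = Suc (card (L2_sep A (gallery_of hs0) (gallery_of hs)))"
  using assms(3)
proof (induction "card (L2_sep A (gallery_of hs0) (gallery_of hs))" arbitrary: hs rule: less_induct)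
  case less
  show ?case
  proof (cases "graded_order hs")
    case True
    then have "hs = hs0" using graded_order_unique less.prems hs0 by blast
    moreover have "min_gallery A (region {}) (gallery_of hs0)"
      using min_gallery_iff[OF hs0(1)] hs0(1) by blast
    ultimately show ?thesis
      using L2_sep_self[OF hs0(1)] by (intro exI[of _ "[gallery_of hs0]"]) (simp add: G2_walk_def)
  next
    case False
    obtain hs' X where hs': "crossing_order hs'"
      and one: "L2_sep A (gallery_of hs') (gallery_of hs) = {X}"
      and X: "X \<in> L2_sep A (gallery_of hs0) (gallery_of hs)"
      and diff: "L2_sep A (gallery_of hs0) (gallery_of hs') =
        L2_sep A (gallery_of hs0) (gallery_of hs) - {X}"
      using descent[OF hs0 less.prems False] by blast
    have card: "card (L2_sep A (gallery_of hs0) (gallery_of hs)) =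
        Suc (card (L2_sep A (gallery_of hs0) (gallery_of hs')))"
      unfolding diff using X finite_L2_sep by (metis card_Suc_Diff1)
    then obtain ws where ws: "G2_walk A (region {}) (gallery_of hs0) (gallery_of hs') ws"
      "length ws = Suc (card (L2_sep A (gallery_of hs0) (gallery_of hs')))"
      using less.hyps[of hs'] hs' by auto
    have g: "min_gallery A (region {}) (gallery_of hs)"
      using min_gallery_iff[OF hs0(1)] less.prems by blast
    have wne: "ws \<noteq> []" "last ws = gallery_of hs'" using ws(1) by (auto simp: G2_walk_def)
    have "card (L2_sep A ((ws @ [gallery_of hs]) ! i) ((ws @ [gallery_of hs]) ! Suc i)) = 1"
      if i: "Suc i < length (ws @ [gallery_of hs])" for i
    proof (cases "Suc i < length ws")
      case True
      then show ?thesis using ws(1) by (simp add: G2_walk_def nth_append)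
    next
      case False
      then have "i = length ws - 1" using i by simp
      then have "ws ! i = gallery_of hs'" "Suc i = length ws" using wne by (auto simp: last_conv_nth)
      then show ?thesis using one by (simp add: nth_append)
    qed
    then have "G2_walk A (region {}) (gallery_of hs0) (gallery_of hs) (ws @ [gallery_of hs])"
      using ws(1) g wne unfolding G2_walk_def by auto
    then show ?thesis using ws(2) card by (intro exI[of _ "ws @ [gallery_of hs]"]) simp
  qed
qed

lemma G2_dist_graded_order:
  assumes "crossing_order hs0" "graded_order hs0" "crossing_order hs"
  shows "G2_dist A (region {}) (gallery_of hs0) (gallery_of hs) =
    enat (card (L2_sep A (gallery_of hs0) (gallery_of hs)))"
proof -
  obtain ws where ws: "G2_walk A (region {}) (gallery_of hs0) (gallery_of hs) ws"
    "length ws = Suc (card (L2_sep A (gallery_of hs0) (gallery_of hs)))"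
    using ex_walk[OF assms] by blast
  show ?thesis unfolding G2_dist_def
  proof (rule antisym)
    show "(INF ws\<in>{ws. G2_walk A (region {}) (gallery_of hs0) (gallery_of hs) ws}. enat (length ws - 1))
        \<le> enat (card (L2_sep A (gallery_of hs0) (gallery_of hs)))"
      using ws by (intro INF_lower2[of ws]) auto
    show "enat (card (L2_sep A (gallery_of hs0) (gallery_of hs)))
        \<le> (INF ws\<in>{ws. G2_walk A (region {}) (gallery_of hs0) (gallery_of hs) ws}. enat (length ws - 1))"
      using card_L2_sep_le_walk[OF assms(1)] by (intro INF_greatest) auto
  qed
qed

end

section \<open>Modular flags\<close>

text \<open>For a hyperplane \<open>H\<close> the least index exists because a flag ends in the
  whole space.\<close>

definition flag_level :: "(nat \<Rightarrow> 'a set) \<Rightarrow> 'a set \<Rightarrow> nat" where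
  "flag_level F H = (LEAST i. \<not> F i \<subseteq> H)"

context oriented_arrangement
begin

text \<open>If \<open>n H\<close> vanished on the part of the closed chamber in \<open>Y\<close>,
  that part would lie in \<open>Y \<inter> H\<close>, too small for incidence. Forms are nonnegative
  on the closed chamber, so the sum of one witness per hyperplane serves all of them.\<close>

lemma incident_point:
  assumes Y: "subspace Y" and inc: "chamber_incident (region {}) Y"
  shows "\<exists>p\<in>Y. \<forall>H\<in>A. \<not> Y \<subseteq> H \<longrightarrow> n H \<bullet> p > 0"
proof -
  have nonneg: "n H \<bullet> x \<ge> 0" if "x \<in> closure (region {})" "H \<in> A" for x H
  proof -
    have "region {} \<subseteq> {x. n H \<bullet> x \<ge> 0}" using regionD(2)[of _ "{}" H] that(2) by fastforce
    then have "closure (region {}) \<subseteq> {x. n H \<bullet> x \<ge> 0}"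
      by (intro closure_minimal closed_halfspace_ge)
    then show ?thesis using that(1) by blast
  qed
  have "\<exists>q. q \<in> closure (region {}) \<inter> Y \<and> n H \<bullet> q > 0" if H: "H \<in> A" "\<not> Y \<subseteq> H" for H
  proof (rule ccontr)
    assume neg: "\<nexists>q. q \<in> closure (region {}) \<inter> Y \<and> n H \<bullet> q > 0"
    have "closure (region {}) \<inter> Y \<subseteq> Y \<inter> H"
    proof
      fix x assume x: "x \<in> closure (region {}) \<inter> Y"
      then have "n H \<bullet> x = 0" using neg nonneg[of x H] H(1) by force
      then show "x \<in> Y \<inter> H" using x mem_hyperplane_iff[OF H(1)] by blast
    qed
    then have "aff_dim (closure (region {}) \<inter> Y) \<le> aff_dim (Y \<inter> H)" by (rule aff_dim_subset)
    moreover have s: "subspace (Y \<inter> H)" using Y subspace_hyperplane_mem[OF H(1)] by (rule subspace_inter)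
    ultimately have "dim Y \<le> dim (Y \<inter> H)"
      using inc by (simp add: chamber_incident_def aff_dim_subspace)
    then have "Y \<inter> H = Y" using subspace_dim_equal[OF s Y] by blast
    then show False using H(2) by blast
  qed
  then obtain q where q: "\<And>H. H \<in> A \<Longrightarrow> \<not> Y \<subseteq> H \<Longrightarrow> q H \<in> closure (region {}) \<inter> Y \<and> n H \<bullet> q H > 0"
    by metis
  define B where "B = {H \<in> A. \<not> Y \<subseteq> H}"
  define p where "p = (\<Sum>H\<in>B. q H)"
  have "p \<in> Y" unfolding p_def using q by (intro subspace_sum[OF Y]) (auto simp: B_def)
  moreover have "n H \<bullet> p > 0" if H: "H \<in> A" "\<not> Y \<subseteq> H" for H
  proof -
    have "n H \<bullet> p = (\<Sum>G\<in>B. n H \<bullet> q G)" by (simp add: p_def inner_sum_right)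
    also have "\<dots> > 0"
    proof (rule sum_pos2)
      show "finite B" using finite_A by (simp add: B_def)
      show "H \<in> B" using H by (simp add: B_def)
      show "0 < n H \<bullet> q H" using q H by blast
      show "0 \<le> n H \<bullet> q G" if "G \<in> B" for G using that q[of G] nonneg[of "q G" H] H(1) by (auto simp: B_def)
    qed
    finally show ?thesis .
  qed
  ultimately show ?thesis by blast
qed

lemma flag_mono:
  assumes "is_flag A F" "i \<le> j" "j \<le> DIM('a)"
  shows "F i \<subseteq> F j"
  using assms(2,3)
proof (induction j rule: dec_induct)
  case (step j)
  have "F j \<subseteq> F (Suc j)" using assms(1) step.prems by (simp add: is_flag_def Suc_le_eq psubset_imp_subset)
  then show ?case using step by auto
qed simp

lemma flag_level:
  assumes F: "is_flag A F" and H: "H \<in> A"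
  shows "0 < flag_level F H" "flag_level F H \<le> DIM('a)"
    "i \<le> DIM('a) \<Longrightarrow> F i \<subseteq> H \<longleftrightarrow> i < flag_level F H"
proof -
  have "n H \<notin> H" using mem_hyperplane_iff[OF H] normal_nonzero[OF H] by simp
  then have top: "\<not> F DIM('a) \<subseteq> H" using F by (auto simp: is_flag_def)
  then show le: "flag_level F H \<le> DIM('a)" unfolding flag_level_def by (rule Least_le)
  have notin: "\<not> F (flag_level F H) \<subseteq> H" unfolding flag_level_def using top by (rule LeastI)
  show iff: "F i \<subseteq> H \<longleftrightarrow> i < flag_level F H" if "i \<le> DIM('a)" for i
  proof
    assume "F i \<subseteq> H"
    then show "i < flag_level F H"
      using notin flag_mono[OF F _ that, of "flag_level F H"] by (meson not_le subset_trans)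
  next
    assume "i < flag_level F H"
    then show "F i \<subseteq> H" using not_less_Least unfolding flag_level_def by blast
  qed
  have "F 0 \<subseteq> H" using F mem_hyperplane_iff[OF H, of 0] by (auto simp: is_flag_def)
  then show "0 < flag_level F H" using iff[of 0] by simp
qed

lemma gallery_incident_flag_iff:
  assumes F: "is_flag A F" and hs: "crossing_order hs"
  shows "gallery_incident_flag A F (gallery_of hs) \<longleftrightarrow>
    (\<forall>G\<in>A. \<forall>H\<in>A. flag_level F H < flag_level F G \<longrightarrow> precedes hs G H)"
proof
  assume inc: "gallery_incident_flag A F (gallery_of hs)"
  show "\<forall>G\<in>A. \<forall>H\<in>A. flag_level F H < flag_level F G \<longrightarrow> precedes hs G H"
  proof (intro ballI impI)
    fix G H assume GH: "G \<in> A" "H \<in> A" "flag_level F H < flag_level F G"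
    \<comment> \<open>Incidence is tested with first index 0 and second index \<open>j\<close>:
      \<open>F 0\<close> lies in every hyperplane of \<open>A\<close>, and \<open>F j\<close> lies
      in \<open>G\<close> but not in \<open>H\<close>.\<close>
    define j where "j = flag_level F H"
    have j: "0 < j" "j \<le> DIM('a)" using flag_level[OF F GH(2)] by (auto simp: j_def)
    have "F j \<subseteq> G" "\<not> F j \<subseteq> H" "F 0 \<subseteq> H"
      using flag_level(3)[OF F GH(1) j(2)] flag_level(3)[OF F GH(2) j(2)] flag_level(3)[OF F GH(2), of 0]
        GH(3) j by (auto simp: j_def)
    then show "precedes hs G H"
      using inc j GH crosses_before_gallery_of[OF hs] unfolding gallery_incident_flag_def by metis
  qed
next
  assume *: "\<forall>G\<in>A. \<forall>H\<in>A. flag_level F H < flag_level F G \<longrightarrow> precedes hs G H"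
  show "gallery_incident_flag A F (gallery_of hs)"
    unfolding gallery_incident_flag_def
  proof (intro allI impI)
    fix i j H H'
    assume "i < j" "j \<le> DIM('a)" "H \<in> A" "H' \<in> A" "F j \<subseteq> H" "F i \<subseteq> H'" "\<not> F j \<subseteq> H'"
    then have "flag_level F H' < flag_level F H"
      using flag_level(3)[OF F \<open>H \<in> A\<close>, of j] flag_level(3)[OF F \<open>H' \<in> A\<close>, of j] by simp
    then show "crosses_before A (gallery_of hs) H H'"
      using * \<open>H \<in> A\<close> \<open>H' \<in> A\<close> crosses_before_gallery_of[OF hs] by blast
  qed
qed

lemma functional_vanishing_on_hyperplane:
  assumes K: "K \<in> A" and a: "\<And>x. x \<in> K \<Longrightarrow> a \<bullet> x = 0"
  shows "a \<bullet> x = (a \<bullet> n K / (n K \<bullet> n K)) * (n K \<bullet> x)"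
proof -
  define t where "t = (n K \<bullet> x) / (n K \<bullet> n K)"
  have "n K \<bullet> n K \<noteq> 0" using normal_nonzero[OF K] by simp
  then have "n K \<bullet> (x - t *\<^sub>R n K) = 0" by (simp add: t_def inner_diff_right)
  then have "a \<bullet> (x - t *\<^sub>R n K) = 0" using a mem_hyperplane_iff[OF K] by blast
  then show ?thesis by (simp add: t_def inner_diff_right)
qed

text \<open>Modularity makes \<open>K = F i + (G \<inter> H)\<close> a hyperplane of
  \<open>A\<close>. The difference of the normalised forms of \<open>G\<close> and \<open>H\<close>
  vanishes on both summands, so it is a multiple of the form of \<open>K\<close>.\<close>

lemma graded_arrangement_of_flag:
  assumes F: "modular_flag A F" and inc: "chamber_incident_flag F (region {})"
  shows "\<exists>w. graded_arrangement A n (flag_level F) w"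
proof -
  have flag: "is_flag A F" using F by (simp add: modular_flag_def)
  have sub: "subspace (F i)" "dim (F i) = i" if "i \<le> DIM('a)" for i
    using flag that subspace_intersections by (auto simp: is_flag_def)
  have "\<exists>p\<in>F i. \<forall>H\<in>A. \<not> F i \<subseteq> H \<longrightarrow> n H \<bullet> p > 0" if "i \<le> DIM('a)" for i
    using incident_point[OF sub(1)[OF that]] inc that by (simp add: chamber_incident_flag_def)
  then obtain w where w: "\<And>i. i \<le> DIM('a) \<Longrightarrow> w i \<in> F i"
    "\<And>i H. i \<le> DIM('a) \<Longrightarrow> H \<in> A \<Longrightarrow> \<not> F i \<subseteq> H \<Longrightarrow> n H \<bullet> w i > 0"
    by metis
  note lev = flag_level[OF flag]
  have "graded_arrangement A n (flag_level F) w"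
  proof
    show "0 < flag_level F H" if "H \<in> A" for H using lev(1)[OF that] .
    show "n H \<bullet> w i = 0" if "H \<in> A" "i < flag_level F H" for H i
    proof -
      have "i \<le> DIM('a)" using lev(2)[OF that(1)] that(2) by simp
      then have "w i \<in> H" using w(1) lev(3)[OF that(1)] that(2) by blast
      then show ?thesis using mem_hyperplane_iff[OF that(1)] by blast
    qed
    show pos: "n H \<bullet> w i > 0"
      if "H \<in> A" "G \<in> A" "flag_level F H \<le> i" "i \<le> flag_level F G" for H G i
    proof -
      \<comment> \<open>\<open>w\<close> is specified only up to index \<open>DIM('a)\<close>; the
        level of \<open>G\<close> provides this bound.\<close>
      have "i \<le> DIM('a)" using lev(2)[OF that(2)] that(4) by simp
      then show ?thesis using w(2)[of i H] lev(3)[OF that(1), of i] that by simp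
    qed
    fix G H assume GH: "G \<in> A" "H \<in> A" "G \<noteq> H" "flag_level F G = flag_level F H"
    define i where "i = flag_level F G"
    have i: "0 < i" "i \<le> DIM('a)" using lev[OF GH(1)] by (auto simp: i_def)
    have low: "F (i - 1) \<subseteq> G" "F (i - 1) \<subseteq> H" "\<not> F i \<subseteq> G" "\<not> F i \<subseteq> H"
      using lev(3)[OF GH(1), of "i - 1"] lev(3)[OF GH(2), of "i - 1"] lev(3)[OF GH(1), of i]
        lev(3)[OF GH(2), of i] i GH(4) by (auto simp: i_def)
    define K where "K = {y + z | y z. y \<in> F i \<and> z \<in> G \<inter> H}"
    have "modular_coatom_rel A (F (i - 1)) (F i)" using F i by (simp add: modular_flag_def)
    then have K: "K \<in> A" using low GH unfolding modular_coatom_rel_def K_def by blast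
    have "0 \<in> G \<inter> H" using mem_hyperplane_iff GH by simp
    then have "F i \<subseteq> K" unfolding K_def by force
    then have levK: "i < flag_level F K" using lev(3)[OF K i(2)] by simp
    have Gw: "n G \<bullet> w i > 0" and Hw: "n H \<bullet> w i > 0" using w(2)[OF i(2)] GH low by auto
    have FG: "F i \<inter> G = F (i - 1)"
    proof -
      have s: "subspace (F i \<inter> G)" using sub(1)[OF i(2)] subspace_hyperplane_mem[OF GH(1)] by (rule subspace_inter)
      have "\<not> dim (F i) \<le> dim (F i \<inter> G)"
        using subspace_dim_equal[OF s sub(1)[OF i(2)]] low(3) by blast
      then have "dim (F i \<inter> G) \<le> dim (F (i - 1))" using sub(2)[OF i(2)] sub(2)[of "i - 1"] i by simp
      moreover have "F (i - 1) \<subseteq> F i \<inter> G" using low flag_mono[OF flag, of "i - 1" i] i by simp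
      ultimately show ?thesis using subspace_dim_equal[OF sub(1)[of "i - 1"] s] i by simp
    qed
    define a where "a = n G /\<^sub>R (n G \<bullet> w i) - n H /\<^sub>R (n H \<bullet> w i)"
    have a: "a \<bullet> x = n G \<bullet> x / (n G \<bullet> w i) - n H \<bullet> x / (n H \<bullet> w i)" for x
      by (simp add: a_def inner_diff_left divide_inverse mult.commute)
    have aF: "a \<bullet> y = 0" if y: "y \<in> F i" for y
    proof -
      \<comment> \<open>The projection of \<open>y\<close> to \<open>G\<close> along
        \<open>w i\<close> lies in \<open>F i \<inter> G = F (i - 1)\<close>, hence in
        \<open>H\<close>. So both normalised forms take the same value at \<open>y\<close>.\<close>
      define y' where "y' = y - (n G \<bullet> y / (n G \<bullet> w i)) *\<^sub>R w i"
      have "n G \<bullet> y' = 0" using Gw by (simp add: y'_def inner_diff_right)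
      then have "y' \<in> F i \<inter> G"
        using y w(1)[OF i(2)] sub(1)[OF i(2)] mem_hyperplane_iff[OF GH(1)]
        by (simp add: y'_def subspace_diff subspace_scale)
      then have "n H \<bullet> y' = 0" using FG low(2) mem_hyperplane_iff[OF GH(2)] by blast
      then show ?thesis using Hw unfolding a by (simp add: y'_def inner_diff_right field_simps)
    qed
    have aK: "a \<bullet> x = 0" if "x \<in> K" for x
    proof -
      obtain y z where yz: "x = y + z" "y \<in> F i" "z \<in> G" "z \<in> H" using \<open>x \<in> K\<close> by (auto simp: K_def)
      then have "a \<bullet> z = 0" using mem_hyperplane_iff[OF GH(1)] mem_hyperplane_iff[OF GH(2)] by (simp add: a)
      then show ?thesis using yz aF by (simp add: inner_add_right)
    qed
    define t where "t = a \<bullet> n K / (n K \<bullet> n K)"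
    have t: "a \<bullet> x = t * (n K \<bullet> x)" for x
      unfolding t_def by (rule functional_vanishing_on_hyperplane[OF K aK])
    have "t \<noteq> 0"
    proof
      assume "t = 0"
      then have eq: "n G \<bullet> x / (n G \<bullet> w i) = n H \<bullet> x / (n H \<bullet> w i)" for x using t[of x] a[of x] by simp
      have "x \<in> G \<longleftrightarrow> x \<in> H" for x
        using eq[of x] Gw Hw mem_hyperplane_iff[OF GH(1)] mem_hyperplane_iff[OF GH(2)]
        by (metis divide_eq_0_iff less_irrefl)
      then show False using GH(3) by blast
    qed
    then show "\<exists>K\<in>A. \<exists>t. flag_level F G < flag_level F K \<and> t \<noteq> 0 \<and>
        (\<forall>x. n G \<bullet> x / (n G \<bullet> w (flag_level F G)) - n H \<bullet> x / (n H \<bullet> w (flag_level F H)) =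
          t * (n K \<bullet> x))"
      using K levK t a GH(4) unfolding i_def by metis
  qed
  then show ?thesis by blast
qed

end

section \<open>Orienting the normals by the base chamber, and the theorem\<close>

lemma ex_orientation:
  assumes A: "central_arrangement A" and c0: "c0 \<in> chambers A"
  obtains n where "oriented_arrangement A n" "c0 = oriented_arrangement.region A n {}"
proof -
  have c: "c0 \<in> components (- \<Union>A)" using c0 by (simp add: chambers_def)
  then obtain x0 where x0: "x0 \<in> c0" using in_components_nonempty by blast
  have notin: "x0 \<notin> H" if "H \<in> A" for H using in_components_subset[OF c] x0 that by blast
  have "\<forall>H\<in>A. \<exists>a. a \<noteq> 0 \<and> H = {x. a \<bullet> x = 0} \<and> a \<bullet> x0 > 0"
  proof
    fix H assume H: "H \<in> A"
    then obtain a where a: "a \<noteq> 0" "H = {x. a \<bullet> x = 0}"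
      using A by (auto simp: central_arrangement_def linear_hyperplane_def)
    show "\<exists>a. a \<noteq> 0 \<and> H = {x. a \<bullet> x = 0} \<and> a \<bullet> x0 > 0"
    proof (cases "a \<bullet> x0 > 0")
      case False
      then have "a \<bullet> x0 < 0" using notin[OF H] a(2) by (metis linorder_neqE_linordered_idom mem_Collect_eq)
      then show ?thesis using a by (intro exI[of _ "- a"]) simp
    qed (use a in blast)
  qed
  then obtain n where n: "\<And>H. H \<in> A \<Longrightarrow> n H \<noteq> 0 \<and> H = {x. n H \<bullet> x = 0} \<and> n H \<bullet> x0 > 0" by metis
  have oa: "oriented_arrangement A n"
    by unfold_locales (use A n in \<open>auto simp: central_arrangement_def\<close>)
  have "{H \<in> A. n H \<bullet> x0 < 0} = {}" using n by (auto dest: less_asym)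
  then have "c0 = oriented_arrangement.region A n {}"
    using oriented_arrangement.component_eq_region[OF oa c x0] by metis
  then show ?thesis using that oa by blast
qed

theorem theorem4p8:
  fixes A :: "'a::euclidean_space set set" and F :: "nat \<Rightarrow> 'a set" and c0 :: "'a set"
  assumes "central_arrangement A" and "essential A" and "supersolvable A"
    and "modular_flag A F"
    and "c0 \<in> chambers A" and "chamber_incident_flag F c0"
  shows "(\<exists>!r0. min_gallery A c0 r0 \<and> gallery_incident_flag A F r0) \<and>
         (\<forall>r0. min_gallery A c0 r0 \<and> gallery_incident_flag A F r0 \<longrightarrow>
            (\<forall>r. min_gallery A c0 r \<longrightarrow> G2_dist A c0 r0 r = enat (card (L2_sep A r0 r))))"
proof -
  obtain n where oa: "oriented_arrangement A n" and c0: "c0 = oriented_arrangement.region A n {}"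
    using ex_orientation assms by blast
  interpret oriented_arrangement A n by (rule oa)
  obtain w where ga: "graded_arrangement A n (flag_level F) w"
    using graded_arrangement_of_flag assms(4,6) c0 by blast
  interpret graded_arrangement A n "flag_level F" w by (rule ga)
  obtain hs0 where hs0: "crossing_order hs0" "graded_order hs0" using ex_graded_order by blast
  have mg: "min_gallery A c0 r \<longleftrightarrow> (\<exists>hs. crossing_order hs \<and> r = gallery_of hs)" for r
    unfolding c0 by (rule min_gallery_iff[OF hs0(1)])
  have inc: "gallery_incident_flag A F (gallery_of hs) \<longleftrightarrow> graded_order hs" if "crossing_order hs" for hs
    using gallery_incident_flag_iff[OF _ that] assms(4)
    by (simp add: modular_flag_def graded_order_def)
  have iff: "min_gallery A c0 r \<and> gallery_incident_flag A F r \<longleftrightarrow> r = gallery_of hs0" for r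
  proof
    assume "min_gallery A c0 r \<and> gallery_incident_flag A F r"
    then obtain hs where hs: "crossing_order hs" "r = gallery_of hs" and "gallery_incident_flag A F r"
      using mg by metis
    then have "graded_order hs" using inc by metis
    then show "r = gallery_of hs0" using graded_order_unique[OF hs(1) _ hs0] hs(2) by metis
  next
    assume "r = gallery_of hs0"
    then show "min_gallery A c0 r \<and> gallery_incident_flag A F r" using mg inc hs0 by metis
  qed
  have "G2_dist A c0 (gallery_of hs0) r = enat (card (L2_sep A (gallery_of hs0) r))"
    if "min_gallery A c0 r" for r
    using that mg G2_dist_graded_order[OF hs0] c0 by auto
  then show ?thesis using iff by simp
qed

end
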